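(* Fix $k=2$ or $k=3$ and $\chi>0$. Let $\{s_n\}_{n\ge0}$ be the monic Sobolev-Legendre orthogonal polynomials of the family $k$, let $\{p_n\}_{n\ge0}$ be the monic Legendre orthogonal polynomials of the same family, and put $s_{-1}:=0$. For $n\ge0$ let $$f_{n+1}(x)=-\int_{SG}G(x,y)\,p_n(y)\,d\mu(y).$$ Then for every $n\ge0$ $$s_{n+1}+a_ns_n+\tilde b_ns_{n-1}=f_{n+1},$$ where $$a_n=\frac{\langle f_{n+1},s_n\rangle_S}{\|s_n\|_S^2},\qquad \tilde b_n=\frac{\langle f_{n+1},s_{n-1}\rangle_S}{\|s_{n-1}\|_S^2}$$ (for $n=0$ the term $\tilde b_0s_{-1}$ is $0$).
   Context: Sierpinski gasket: let $q_0=(\tfrac12,\tfrac{\sqrt3}{2})$, $q_1=(0,0)$, $q_2=(1,0)$, $V_0=\{q_0,q_1,q_2\}$, $F_i(x)=\tfrac12(x-q_i)+q_i$, and let $SG\subset\mathbb R^2$ be the unique nonempty compact set with $SG=\bigcup_{i=0}^2F_i(SG)$. For a word $w=(w_1,\dots,w_m)\in\{0,1,2\}^m$, $|w|=m$, put $F_w=F_{w_1}\circ\cdots\circ F_{w_m}$; $F_w(SG)$ is called an $m$-cell; $V_m=\bigcup_{|w|=m}F_w(V_0)$; distinct $x,y\in V_m$ satisfy $x\sim_m y$ if they lie in a common $m$-cell. $\mu$ is the self-similar Borel probability measure with $\mu(F_w(SG))=3^{-|w|}$. All functions are real-valued. Energy and Laplacian: $\mathscr E(u,v)=\lim_{m\to\infty}(3/5)^{-m}\sum_{x\sim_m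 y}(u(x)-u(y))(v(x)-v(y))$ (sum over unordered pairs), and $u\in\operatorname{dom}\mathscr E$ if $\mathscr E(u,u)$ exists and is finite. For $u\in\operatorname{dom}\mathscr E$ and $f$ continuous, $\Delta u=f$ means $\mathscr E(u,v)=-\int_{SG}fv\,d\mu$ for all $v\in\operatorname{dom}\mathscr E$ vanishing on $V_0$. Indices of $q_i$ are mod 3. Normal derivative: $\partial_nu(q_i)=\lim_m(5/3)^m(2u(q_i)-u(F_i^mq_{i+1})-u(F_i^mq_{i-1}))$. Tangential derivative: $\partial_Tu(q_i)=\lim_m5^m(u(F_i^mq_{i+1})-u(F_i^mq_{i-1}))$. Green's function: $G(x,y)$ is the (continuous, symmetric) Green's function of the Dirichlet problem: for $f$ continuous, $-\Delta u=f$ and $u|_{V_0}=0$ iff $u(x)=\int_{SG}G(x,y)f(y)\,d\mu(y)$. Monomials: for $j\ge0$, $k\in\{1,2,3\}$, $P_{j,k}$ is the unique function with $\Delta^{j+1}P_{j,k}=0$ such that for all $0\le n\le j$: $\Delta^nP_{j,k}(q_0)=\delta_{nj}\delta_{k1}$, $\partial_n\Delta^nP_{j,k}(q_0)=\delta_{nj}\delta_{k2}$, $\partial_T\Delta^nP_{j,k}(q_0)=\delta_{nj}\delta_{k3}$. In particular $\Delta P_{j,k}=P_{j-1,k}$ with $P_{-1,k}=0$. Inner products: $\langle f,g\rangle_2=\int_{SG}fg\,d\mu$; $\langle f,g\rangle_S=\int_{SG}fg\,d\mu+\chi\int_{SG}\Delta f\,\Delta g\,d\mu$ with norm $\|\cdot\|_S$.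 For fixed $k$, $\{p_{n}\}$ (monic Legendre) and $\{s_{n}\}$ (monic Sobolev-Legendre) are obtained from $P_{0,k},P_{1,k},\dots$ by Gram-Schmidt without normalization with respect to $\langle\cdot,\cdot\rangle_2$ and $\langle\cdot,\cdot\rangle_S$ respectively; i.e. each of $p_{n}$, $s_{n}$ equals $P_{n,k}$ plus a linear combination of $P_{0,k},\dots,P_{n-1,k}$ and is orthogonal to $P_{0,k},\dots,P_{n-1,k}$. *)

theory Defs
  imports "HOL-Probability.Probability"
begin

section \<open>The gasket\<close>

text \<open>Boundary indices are read modulo 3, and \<open>i - 1\<close> is written \<open>i + 2\<close>.\<close>

definition q :: "nat \<Rightarrow> real^2" where
  "q i = (if i mod 3 = 0 then vector [1/2, sqrt 3 / 2]
          else if i mod 3 = 1 then vector [0, 0]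
          else vector [1, 0])"

definition F :: "nat \<Rightarrow> real^2 \<Rightarrow> real^2" where
  "F i x = (1/2) *\<^sub>R (x - q i) + q i"

definition is_gasket :: "(real^2) set \<Rightarrow> bool" where
  "is_gasket K \<longleftrightarrow> compact K \<and> K \<noteq> {} \<and> K = (\<Union>i\<in>{0,1,2}. F i ` K)"

definition SG :: "(real^2) set" where
  "SG = (THE K. is_gasket K)"

primrec Fw :: "nat list \<Rightarrow> real^2 \<Rightarrow> real^2" where
  "Fw [] = id"
| "Fw (i # w) = F i \<circ> Fw w"

definition words :: "nat \<Rightarrow> nat list set" where
  "words m = {w. set w \<subseteq> {0,1,2} \<and> length w = m}"

definition V :: "nat \<Rightarrow> (real^2) set" where
  "V m = (\<Union>w\<in>words m. Fw w ` {q 0, q 1, q 2})"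

definition adj :: "nat \<Rightarrow> real^2 \<Rightarrow> real^2 \<Rightarrow> bool" where
  "adj m x y \<longleftrightarrow> x \<in> V m \<and> y \<in> V m \<and> x \<noteq> y \<and> (\<exists>w\<in>words m. x \<in> Fw w ` SG \<and> y \<in> Fw w ` SG)"

definition is_SG_measure :: "(real^2) measure \<Rightarrow> bool" where
  "is_SG_measure \<mu> \<longleftrightarrow> prob_space \<mu> \<and> sets \<mu> = sets borel \<and>
     (\<forall>A\<in>sets borel. measure \<mu> A = (\<Sum>i\<in>{0,1,2}. (1/3) * measure \<mu> (F i -` A))) \<and>
     (\<forall>m. \<forall>w\<in>words m. measure \<mu> (Fw w ` SG) = (1/3) ^ m)"


section \<open>Energy, Laplacian and boundary derivatives\<close>

text \<open>
  Functions on the gasket are represented by functions on the plane; no notion below depends on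
  the values off \<^const>\<open>SG\<close>.
\<close>

text \<open>The factor 1/2 turns the sum over ordered pairs into the sum over unordered pairs.\<close>

definition graph_energy :: "nat \<Rightarrow> (real^2 \<Rightarrow> real) \<Rightarrow> (real^2 \<Rightarrow> real) \<Rightarrow> real" where
  "graph_energy m u v =
     inverse ((3/5) ^ m) * ((1/2) * (\<Sum>(x,y) | adj m x y. (u x - u y) * (v x - v y)))"

definition has_energy :: "(real^2 \<Rightarrow> real) \<Rightarrow> (real^2 \<Rightarrow> real) \<Rightarrow> real \<Rightarrow> bool" where
  "has_energy u v e \<longleftrightarrow> (\<lambda>m. graph_energy m u v) \<longlonglongrightarrow> e"

text \<open>
  The energy only sees the countable set of vertices. Continuity is therefore part of the domain,
  as is standard: functions of finite energy are identified with their continuous extensions.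
\<close>

definition dom_energy :: "(real^2 \<Rightarrow> real) set" where
  "dom_energy = {u. continuous_on SG u \<and> (\<exists>e. has_energy u u e)}"

definition has_laplacian ::
  "(real^2) measure \<Rightarrow> (real^2 \<Rightarrow> real) \<Rightarrow> (real^2 \<Rightarrow> real) \<Rightarrow> bool" where
  "has_laplacian \<mu> u f \<longleftrightarrow> u \<in> dom_energy \<and> continuous_on SG f \<and>
     (\<forall>v\<in>dom_energy. (\<forall>x\<in>V 0. v x = 0) \<longrightarrow> has_energy u v (- (LINT x:SG|\<mu>. f x * v x)))"

text \<open>The Laplacian is determined on \<^const>\<open>SG\<close>, and only there; hence a choice operator.\<close>

definition laplacian :: "(real^2) measure \<Rightarrow> (real^2 \<Rightarrow> real) \<Rightarrow> real^2 \<Rightarrow> real" where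
  "laplacian \<mu> u = (SOME f. has_laplacian \<mu> u f)"

definition has_normal_deriv :: "(real^2 \<Rightarrow> real) \<Rightarrow> nat \<Rightarrow> real \<Rightarrow> bool" where
  "has_normal_deriv u i d \<longleftrightarrow>
     (\<lambda>m. (5/3) ^ m * (2 * u (q i) - u ((F i ^^ m) (q (i + 1))) - u ((F i ^^ m) (q (i + 2)))))
       \<longlonglongrightarrow> d"

definition has_tangential_deriv :: "(real^2 \<Rightarrow> real) \<Rightarrow> nat \<Rightarrow> real \<Rightarrow> bool" where
  "has_tangential_deriv u i d \<longleftrightarrow>
     (\<lambda>m. 5 ^ m * (u ((F i ^^ m) (q (i + 1))) - u ((F i ^^ m) (q (i + 2))))) \<longlonglongrightarrow> d"

definition is_green :: "(real^2) measure \<Rightarrow> (real^2 \<Rightarrow> real^2 \<Rightarrow> real) \<Rightarrow> bool" where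
  "is_green \<mu> G \<longleftrightarrow>
     continuous_on (SG \<times> SG) (\<lambda>(x,y). G x y) \<and>
     (\<forall>x\<in>SG. \<forall>y\<in>SG. G x y = G y x) \<and>
     (\<forall>f u. continuous_on SG f \<longrightarrow>
        (has_laplacian \<mu> u (\<lambda>x. - f x) \<and> (\<forall>x\<in>V 0. u x = 0)
         \<longleftrightarrow> (\<forall>x\<in>SG. u x = (LINT y:SG|\<mu>. G x y * f y))))"


section \<open>Monomials and orthogonal polynomials\<close>

text \<open>\<open>D n\<close> is the \<open>n\<close>-fold Laplacian of \<open>P\<close>.\<close>

definition is_monomial :: "(real^2) measure \<Rightarrow> nat \<Rightarrow> nat \<Rightarrow> (real^2 \<Rightarrow> real) \<Rightarrow> bool" where
  "is_monomial \<mu> j k P \<longleftrightarrow> (\<exists>D. D 0 = P \<and>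
     (\<forall>n\<le>j. has_laplacian \<mu> (D n) (D (Suc n))) \<and>
     (\<forall>x\<in>SG. D (Suc j) x = 0) \<and>
     (\<forall>n\<le>j. D n (q 0) = of_bool (n = j \<and> k = 1) \<and>
             has_normal_deriv (D n) 0 (of_bool (n = j \<and> k = 2)) \<and>
             has_tangential_deriv (D n) 0 (of_bool (n = j \<and> k = 3))))"

definition inner2 :: "(real^2) measure \<Rightarrow> (real^2 \<Rightarrow> real) \<Rightarrow> (real^2 \<Rightarrow> real) \<Rightarrow> real" where
  "inner2 \<mu> f g = (LINT x:SG|\<mu>. f x * g x)"

definition innerS ::
  "(real^2) measure \<Rightarrow> real \<Rightarrow> (real^2 \<Rightarrow> real) \<Rightarrow> (real^2 \<Rightarrow> real) \<Rightarrow> real" where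
  "innerS \<mu> chi f g = inner2 \<mu> f g + chi * inner2 \<mu> (laplacian \<mu> f) (laplacian \<mu> g)"

definition normS :: "(real^2) measure \<Rightarrow> real \<Rightarrow> (real^2 \<Rightarrow> real) \<Rightarrow> real" where
  "normS \<mu> chi f = sqrt (innerS \<mu> chi f f)"

text \<open>\<open>p\<close> is obtained from \<open>P\<close> by Gram--Schmidt without normalization with respect to \<open>ip\<close>.\<close>

definition monic_orthogonal ::
  "((real^2 \<Rightarrow> real) \<Rightarrow> (real^2 \<Rightarrow> real) \<Rightarrow> real) \<Rightarrow>
   (nat \<Rightarrow> real^2 \<Rightarrow> real) \<Rightarrow> (nat \<Rightarrow> real^2 \<Rightarrow> real) \<Rightarrow> bool" where
  "monic_orthogonal ip P p \<longleftrightarrow>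
     (\<forall>n. (\<exists>c. \<forall>x\<in>SG. p n x = P n x + (\<Sum>i<n. c i * P i x)) \<and> (\<forall>i<n. ip (p n) (P i) = 0))"


section \<open>The gasket is well defined\<close>

lemma F_alt: "F i x = (1/2) *\<^sub>R q i + (1/2) *\<^sub>R x"
  by (simp add: F_def vec_eq_iff field_simps)

lemma dist_F: "dist (F i x) (F i y) = dist x y / 2"
  by (simp add: F_alt dist_norm flip: scaleR_diff_right)

lemma F_closure: "F i ` closure A = closure (F i ` A)"
proof -
  have *: "F i ` B = (+) ((1/2) *\<^sub>R q i) ` (*\<^sub>R) (1/2) ` B" for B
    by (auto simp: F_alt image_image)
  show ?thesis unfolding * closure_scaleR closure_translation ..
qed

lemma F_closure_Union:
  "closure (\<Union>i\<in>{0,1,2}. F i ` A) = (\<Union>i\<in>{0,1,2}. F i ` closure A)"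
  by (simp add: F_closure)

lemma ex_gasket: "\<exists>K. is_gasket K"
proof -
  let ?A = "\<Union>m. \<Union>w\<in>words m. {Fw w (q 0)}"
  let ?R = "norm (q 0) + norm (q 1) + norm (q 2)"
  have "norm (Fw w (q 0)) \<le> ?R" if "set w \<subseteq> {0,1,2}" for w
    using that
  proof (induction w)
    case Nil
    then show ?case by simp
  next
    case (Cons i w)
    have "norm (F i x) \<le> norm (q i) / 2 + norm x / 2" for x
      unfolding F_alt by (rule order_trans[OF norm_triangle_ineq]) simp
    from this[of "Fw w (q 0)"] have "norm (Fw (i # w) (q 0)) \<le> norm (q i) / 2 + norm (Fw w (q 0)) / 2"
      by simp
    moreover have "norm (q i) \<le> ?R" using Cons.prems by auto
    ultimately show ?case using Cons by simp
  qed
  then have bounded: "bounded ?A"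
    by (auto simp: bounded_iff words_def)
  have fix0: "F 0 (q 0) = q 0" by (simp add: F_def)
  have "?A = (\<Union>i\<in>{0,1,2}. F i ` ?A)"
  proof (intro equalityI subsetI)
    fix x assume "x \<in> ?A"
    then obtain w where w: "set w \<subseteq> {0,1,2}" "x = Fw w (q 0)" by (auto simp: words_def)
    show "x \<in> (\<Union>i\<in>{0,1,2}. F i ` ?A)"
    proof (cases w)
      case Nil
      then have "x = F 0 (Fw [] (q 0))" using w fix0 by simp
      moreover have "[] \<in> words 0" by (simp add: words_def)
      ultimately show ?thesis by blast
    next
      case (Cons i v)
      then have "x = F i (Fw v (q 0))" "v \<in> words (length v)" "i \<in> {0,1,2}"
        using w by (auto simp: words_def)
      then show ?thesis by blast
    qed
  next
    fix x assume "x \<in> (\<Union>i\<in>{0,1,2}. F i ` ?A)"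
    then obtain i m v where v: "i \<in> {0,1,2}" "v \<in> words m" "x = F i (Fw v (q 0))" by blast
    then have "i # v \<in> words (Suc m)" "x = Fw (i # v) (q 0)" by (auto simp: words_def)
    then show "x \<in> ?A" by blast
  qed
  then have "closure ?A = closure (\<Union>i\<in>{0,1,2}. F i ` ?A)" by (rule arg_cong)
  also have "\<dots> = (\<Union>i\<in>{0,1,2}. F i ` closure ?A)" by (rule F_closure_Union)
  finally have "closure ?A = (\<Union>i\<in>{0,1,2}. F i ` closure ?A)" .
  moreover have "[] \<in> words 0" by (simp add: words_def)
  then have "closure ?A \<noteq> {}" unfolding closure_eq_empty by blast
  moreover have "compact (closure ?A)" using bounded by (simp add: compact_closure)
  ultimately have "is_gasket (closure ?A)"
    unfolding is_gasket_def by (intro conjI)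
  then show ?thesis ..
qed

lemma is_gasketD:
  assumes "is_gasket K"
  shows "compact K" "K \<noteq> {}" "(\<Union>i\<in>{0,1,2}. F i ` K) = K"
proof -
  have *: "compact K \<and> K \<noteq> {} \<and> K = (\<Union>i\<in>{0,1,2}. F i ` K)"
    using assms unfolding is_gasket_def .
  show "compact K" using * by (rule conjunct1)
  show "K \<noteq> {}" using *[THEN conjunct2] by (rule conjunct1)
  show "(\<Union>i\<in>{0,1,2}. F i ` K) = K" using *[THEN conjunct2, THEN conjunct2] by (rule sym)
qed

lemma gasket_subset:
  assumes K: "is_gasket K" and L: "is_gasket L"
  shows "K \<subseteq> L"
proof -
  have cl: "closed L" "L \<noteq> {}" using is_gasketD[OF L] by (auto intro: compact_imp_closed)
  have "compact K" "K \<noteq> {}" using is_gasketD[OF K] by blast+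
  moreover have "continuous_on K (\<lambda>x. infdist x L)" by (intro continuous_intros)
  ultimately obtain x where x: "x \<in> K" "\<And>y. y \<in> K \<Longrightarrow> infdist y L \<le> infdist x L"
    using continuous_attains_sup[of K "\<lambda>x. infdist x L"] by blast
  have "x \<in> (\<Union>i\<in>{0,1,2}. F i ` K)"
    unfolding is_gasketD(3)[OF K] by (rule x(1))
  then obtain i y where y: "i \<in> {0,1,2}" "y \<in> K" "x = F i y"
    by blast
  obtain z where z: "z \<in> L" "infdist y L = dist y z"
    using infdist_attains_inf[OF cl, of y] by blast
  have "F i z \<in> (\<Union>i\<in>{0,1,2}. F i ` L)" using y(1) z(1) by blast
  then have "F i z \<in> L" unfolding is_gasketD(3)[OF L] .
  then have "infdist x L \<le> dist x (F i z)" by (rule infdist_le)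
  also have "\<dots> = infdist y L / 2" by (simp add: y(3) z(2) dist_F)
  finally have "infdist x L \<le> 0" using x(2)[OF y(2)] infdist_nonneg[of x L] by linarith
  then have "infdist u L = 0" if "u \<in> K" for u
    using x(2)[OF that] infdist_nonneg[of u L] by linarith
  then show ?thesis using in_closed_iff_infdist_zero[OF cl] by blast
qed

lemma is_gasket_SG: "is_gasket SG"
proof -
  obtain K where K: "is_gasket K" using ex_gasket ..
  show ?thesis unfolding SG_def
    using K by (rule theI) (intro equalityI gasket_subset K, assumption+)
qed

end

theory Submission
  imports Defs
begin

text \<open>
  The function \<open>f (n + 1)\<close> has Laplacian \<open>p n\<close> and vanishes on \<^term>\<open>V 0\<close>. Monomials are determined by
  their jets at \<^term>\<open>q 0\<close>, so for \<open>k = 2\<close> (\<open>k = 3\<close>) they are even (odd) under the reflection fixing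
  \<^term>\<open>q 0\<close>, and hence a multiple of the harmonic monomial \<open>P 0 k\<close> corrects the boundary values of
  \<open>P (j + 1) k\<close>. Consequently Green's operator maps \<open>P j k\<close> into the span of \<open>P (j + 1) k\<close> and
  \<open>P 0 k\<close>, and \<open>f (n + 1) - P (n + 1) k\<close> lies in the span of \<open>P 0 k, \<dots>, P n k\<close>. By symmetry
  of Green's operator, for \<open>j < n - 1\<close> both terms of the Sobolev product of \<open>f (n + 1)\<close> with \<open>P j k\<close>
  reduce to products of \<open>p n\<close> with monomials of degree less than \<open>n\<close>, and vanish; so only the
  coefficients of \<open>s n\<close> and \<open>s (n - 1)\<close> survive in the expansion of \<open>f (n + 1)\<close>.

  The Laplacian is single-valued because functions of finite energy can be localized to arbitrarily
  small cells.
\<close>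

section \<open>Cells, edges and energy\<close>

text \<open>Measure, Green's function and monomials enter only through their defining properties,
  and everything else has to be extracted from these. Nonzero functions of finite energy vanishing
  on \<open>V 0\<close> are made from \<open>P 0 2\<close>, whose normal derivative keeps it from
  being constant; no harmonic extension is built. Reflection invariance of integrals comes from the
  cell measures, by Riemann sums. The Laplacian inside \<open>innerS\<close> is a choice operator,
  so a Sobolev product can be evaluated only once any two Laplacians of a function are known to
  agree on \<open>SG\<close>.

  The restriction on \<open>k\<close> comes from the boundary correction: \<open>P 0 1\<close> is 1
  at \<open>q 0\<close>, where \<open>P (j + 1) 1\<close> is 0, so adding a nonzero multiple of it
  to adjust \<open>q 1\<close> and \<open>q 2\<close> would spoil the value at \<open>q 0\<close>.

  The recursion is checked through the difference of its two sides: the leading terms cancel, so it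
  lies in the span of \<open>P 0 k\<close>, ..., \<open>P n k\<close>; it is Sobolev-orthogonal to
  that span, hence to itself.\<close>

text \<open>Barycentric coordinates with respect to \<open>q 0\<close>, \<open>q 1\<close>,
  \<open>q 2\<close>. Under \<open>F j\<close> they are halved and the one with index
  \<open>j\<close> gains 1/2, which turns overlaps of cells into arithmetic.\<close>

definition bary :: "nat \<Rightarrow> real^2 \<Rightarrow> real" where
  "bary i x = (if i = 0 then 2 / sqrt 3 * x$2
     else if i = 1 then 1 - x$1 - x$2 / sqrt 3 else x$1 - x$2 / sqrt 3)"

lemma bary_sum: "bary 0 x + bary 1 x + bary 2 x = 1"
  by (simp add: bary_def)

lemma q_coords:
  "q 0 $ 1 = 1/2" "q 0 $ 2 = sqrt 3 / 2" "q 1 $ 1 = 0" "q 1 $ 2 = 0" "q 2 $ 1 = 1" "q 2 $ 2 = 0"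
  by (simp_all add: q_def)

lemma bary_q:
  assumes "i \<in> {0,1,2}" "j \<in> {0,1,2}"
  shows "bary i (q j) = of_bool (i = j)"
proof -
  have "i = 0 \<or> i = 1 \<or> i = 2" "j = 0 \<or> j = 1 \<or> j = 2" using assms by auto
  then show ?thesis by (elim disjE) (simp_all add: bary_def q_coords del: One_nat_def)
qed

lemma bary_F:
  assumes "i \<in> {0,1,2}" "j \<in> {0,1,2}"
  shows "bary i (F j x) = (bary i x + of_bool (i = j)) / 2"
proof -
  have "bary i (F j x) = (bary i x + bary i (q j)) / 2"
    unfolding bary_def F_alt by (simp add: add_divide_distrib diff_divide_distrib distrib_left)
  then show ?thesis using bary_q[OF assms] by simp
qed

lemma bary_eqI:
  assumes "\<And>i. i \<in> {0,1,2} \<Longrightarrow> bary i x = bary i y"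
  shows "x = y"
proof -
  have "x$2 = y$2" using assms[of 0] by (simp add: bary_def)
  moreover from this have "x$1 = y$1" using assms[of 2] by (simp add: bary_def)
  ultimately show ?thesis by (simp add: vec_eq_iff forall_2)
qed

lemma F_inject: "F i x = F i y \<longleftrightarrow> x = y"
  by (simp add: F_alt)

lemma F_q_self: "F i (q i) = q i"
  by (simp add: F_def)

lemma F_q_swap: "F i (q j) = F j (q i)"
  by (simp add: F_alt add.commute)

lemma continuous_on_F: "continuous_on A (F i)"
  by (auto simp: F_def intro!: continuous_intros)

lemma SG_eq: "SG = F 0 ` SG \<union> F 1 ` SG \<union> F 2 ` SG"
  using is_gasketD(3)[OF is_gasket_SG] by auto

lemma compact_SG: "compact SG" and SG_ne: "SG \<noteq> {}"
  using is_gasketD[OF is_gasket_SG] by auto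

lemma F_SG: "i \<in> {0,1,2} \<Longrightarrow> x \<in> SG \<Longrightarrow> F i x \<in> SG"
  using SG_eq by blast

lemma SG_cases:
  assumes "x \<in> SG"
  obtains i y where "i \<in> {0,1,2}" "y \<in> SG" "x = F i y"
  using assms SG_eq by blast

lemma Fpow_dist: "dist ((F i ^^ n) x) (q i) = dist x (q i) / 2 ^ n"
proof (induction n)
  case (Suc n)
  have "dist ((F i ^^ Suc n) x) (q i) = dist (F i ((F i ^^ n) x)) (F i (q i))"
    by (simp add: F_q_self)
  then show ?case using Suc by (simp add: dist_F)
qed simp

lemma Fpow_tendsto: "(\<lambda>n. (F i ^^ n) x) \<longlonglongrightarrow> q i"
  unfolding tendsto_dist_iff[of _ "q i"] Fpow_dist
  by real_asymp

lemma Fpow_SG: "i \<in> {0,1,2} \<Longrightarrow> x \<in> SG \<Longrightarrow> (F i ^^ n) x \<in> SG"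
  by (induction n) (auto intro!: F_SG)

lemma q_SG:
  assumes "i \<in> {0,1,2}"
  shows "q i \<in> SG"
proof -
  obtain x where x: "x \<in> SG" using SG_ne by blast
  show ?thesis
    by (rule closed_sequentially[OF compact_imp_closed[OF compact_SG], of "\<lambda>n. (F i ^^ n) x"])
       (use Fpow_SG[OF assms x] Fpow_tendsto in auto)
qed

text \<open>At a minimum point \<open>z = F j y\<close> the coordinate is at least half its value at
  \<open>y\<close>, hence at least half the minimum itself; so the minimum cannot be
  negative.\<close>

lemma bary_nonneg:
  assumes "i \<in> {0,1,2}" "x \<in> SG"
  shows "bary i x \<ge> 0"
proof -
  have "continuous_on SG (bary i)"
    unfolding bary_def
    by (cases "i = 0"; cases "i = 1") (simp_all, (intro continuous_intros; simp)+)
  then obtain z where z: "z \<in> SG" "\<And>y. y \<in> SG \<Longrightarrow> bary i z \<le> bary i y"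
    using continuous_attains_inf[OF compact_SG SG_ne] by metis
  obtain j y where y: "j \<in> {0,1,2}" "y \<in> SG" "z = F j y"
    using z(1) by (rule SG_cases)
  have "bary i z \<ge> bary i y / 2"
    using bary_F[OF assms(1) y(1), of y] y(3) by (auto split: if_splits)
  then show ?thesis using z(2)[OF y(2)] z(2)[OF assms(2)] by linarith
qed

lemma bary_le_1:
  assumes "i \<in> {0,1,2}" "x \<in> SG"
  shows "bary i x \<le> 1"
  using bary_sum[of x] bary_nonneg[OF _ assms(2), of 0] bary_nonneg[OF _ assms(2), of 1]
    bary_nonneg[OF _ assms(2), of 2] assms(1) by auto

text \<open>Comparing \<open>j\<close>-th coordinates gives \<open>bary j x = bary j y + 1\<close>,
  so that of \<open>x\<close> is 1 and the other two are 0. This finite ramification is what makes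
  edges, energies and gluing decompose along cells.\<close>

lemma F_meet:
  assumes i: "i \<in> {0,1,2}" and j: "j \<in> {0,1,2}" and "i \<noteq> j"
    and x: "x \<in> SG" and y: "y \<in> SG" and eq: "F i x = F j y"
  shows "x = q j"
proof (rule bary_eqI)
  fix l :: nat assume l: "l \<in> {0,1,2}"
  have xl: "bary l x + of_bool (l = i) = bary l y + of_bool (l = j)" if "l \<in> {0,1,2}" for l
    using arg_cong[OF eq, of "bary l"] bary_F[OF that i, of x] bary_F[OF that j, of y] by simp
  have j1: "bary j x = 1"
    using xl[OF j] bary_nonneg[OF j y] bary_le_1[OF j x] \<open>i \<noteq> j\<close> by auto
  have "bary l x = 0" if "l \<noteq> j"
    using bary_sum[of x] j1 bary_nonneg[OF _ x, of 0] bary_nonneg[OF _ x, of 1]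
      bary_nonneg[OF _ x, of 2] l j that by auto
  then show "bary l x = bary l (q j)"
    using j1 bary_q[OF l j] by auto
qed

section \<open>Words, cells and vertices\<close>

lemma words_0: "words 0 = {[]}"
  by (auto simp: words_def)

lemma words_Suc: "words (Suc m) = (\<lambda>(i,w). i # w) ` ({0,1,2} \<times> words m)"
  by (auto simp: words_def length_Suc_conv image_iff)

lemma UN_words_Suc: "(\<Union>w\<in>words (Suc m). h w) = (\<Union>i\<in>{0,1,2}. \<Union>w\<in>words m. h (i # w))"
proof -
  have "(\<Union>v\<in>(\<lambda>(i,w). i # w) ` (I \<times> W). h v) = (\<Union>i\<in>I. \<Union>w\<in>W. h (i # w))" for I W
    by auto
  then show ?thesis unfolding words_Suc .
qed

lemma finite_words: "finite (words m)"
  by (induction m) (auto simp: words_0 words_Suc)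

lemma card_words: "card (words m) = 3 ^ m"
  by (induction m) (auto simp: words_0 words_Suc card_image inj_on_def card_cartesian_product)

lemma Fw_SG: "w \<in> words m \<Longrightarrow> x \<in> SG \<Longrightarrow> Fw w x \<in> SG"
  by (induction m arbitrary: w) (auto simp: words_0 words_Suc intro!: F_SG)

lemma SG_words: "SG = (\<Union>w\<in>words m. Fw w ` SG)"
proof (induction m)
  case (Suc m)
  have "SG = (\<Union>i\<in>{0,1,2}. F i ` (\<Union>w\<in>words m. Fw w ` SG))"
    unfolding Suc[symmetric] using SG_eq by auto
  also have "\<dots> = (\<Union>w\<in>words (Suc m). Fw w ` SG)"
    unfolding UN_words_Suc Fw.simps image_UN image_comp ..
  finally show ?case .
qed (simp add: words_0)

lemma dist_Fw: "dist (Fw w x) (Fw w y) = dist x y / 2 ^ length w"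
  by (induction w) (auto simp: dist_F)

lemma V_0: "V 0 = {q 0, q 1, q 2}"
  by (simp add: V_def words_0)

lemma V_Suc: "V (Suc m) = F 0 ` V m \<union> F 1 ` V m \<union> F 2 ` V m"
proof -
  have "V (Suc m) = (\<Union>i\<in>{0,1,2}. \<Union>w\<in>words m. (F i \<circ> Fw w) ` {q 0, q 1, q 2})"
    unfolding V_def UN_words_Suc by (simp only: Fw.simps)
  also have "\<dots> = (\<Union>i\<in>{0,1,2}. F i ` V m)"
    unfolding V_def image_UN image_comp ..
  finally show ?thesis by auto
qed

lemma finite_V: "finite (V m)"
  by (induction m) (auto simp: V_0 V_Suc)

lemma V_subset_SG: "V m \<subseteq> SG"
  by (induction m) (auto simp: V_0 V_Suc q_SG F_SG)

lemma q_V: "i \<in> {0,1,2} \<Longrightarrow> q i \<in> V m"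
proof (induction m)
  case (Suc m)
  then have "F i (q i) \<in> V (Suc m)" by (auto simp: V_Suc)
  then show ?case by (simp add: F_q_self)
qed (auto simp: V_0)

text \<open>If the vertex arises from a different map \<open>F j\<close>, then \<open>F_meet\<close>
  makes \<open>x\<close> the boundary point \<open>q j\<close>, which is a vertex of every
  level.\<close>

lemma V_cell:
  assumes i: "i \<in> {0,1,2}" and x: "x \<in> SG" and Fx: "F i x \<in> V (Suc m)"
  shows "x \<in> V m"
proof -
  obtain j y where j: "j \<in> {0,1,2}" and y: "y \<in> V m" and eq: "F i x = F j y"
    using Fx by (auto simp: V_Suc)
  show ?thesis
  proof (cases "i = j")
    case True
    then have "x = y" using eq by (simp add: F_inject)
    then show ?thesis using y by simp
  next
    case False
    then have "x = q j" using F_meet[OF i j _ x _ eq] y V_subset_SG by blast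
    then show ?thesis using q_V[OF j] by simp
  qed
qed

section \<open>Edges and self-similarity of the graph energies\<close>

definition edges :: "nat \<Rightarrow> ((real^2) \<times> (real^2)) set" where
  "edges m = {(x,y). adj m x y}"

lemma edges_V: "(x,y) \<in> edges m \<Longrightarrow> x \<in> V m \<and> y \<in> V m \<and> x \<noteq> y"
  by (simp add: edges_def adj_def)

lemma edges_SG: "(x,y) \<in> edges m \<Longrightarrow> x \<in> SG \<and> y \<in> SG"
  using V_subset_SG edges_V by blast

lemma finite_edges: "finite (edges m)"
proof (rule finite_subset)
  show "edges m \<subseteq> V m \<times> V m" using edges_V by fast
  show "finite (V m \<times> V m)" using finite_V by simp
qed

lemma edges_0: "edges 0 = {(x,y). x \<in> V 0 \<and> y \<in> V 0 \<and> x \<noteq> y}"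
proof -
  have "adj 0 x y \<longleftrightarrow> x \<in> V 0 \<and> y \<in> V 0 \<and> x \<noteq> y" for x y
    unfolding adj_def words_0 using V_subset_SG[of 0] by (simp add: subset_iff) blast
  then show ?thesis unfolding edges_def by auto
qed

text \<open>The first letter of a word whose cell contains both ends tells which \<open>F i\<close>
  to undo, and \<open>V_cell\<close> ensures that the preimages are vertices one level down.\<close>

lemma edges_Suc: "edges (Suc m) = (\<Union>i\<in>{0,1,2}. map_prod (F i) (F i) ` edges m)"
proof (intro equalityI subsetI)
  fix e assume "e \<in> edges (Suc m)"
  then obtain x y v where e: "e = (x,y)" "x \<in> V (Suc m)" "y \<in> V (Suc m)" "x \<noteq> y"
      "v \<in> words (Suc m)" "x \<in> Fw v ` SG" "y \<in> Fw v ` SG"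
    by (auto simp: edges_def adj_def)
  obtain i w where v: "v = i # w" "i \<in> {0,1,2}" "w \<in> words m"
    using e(5) by (auto simp: words_Suc)
  obtain x' y' where xy: "x' \<in> SG" "y' \<in> SG" "x = F i (Fw w x')" "y = F i (Fw w y')"
    using e(6,7) v(1) by auto
  have "(Fw w x', Fw w y') \<in> edges m"
    using xy e V_cell[OF v(2) Fw_SG[OF v(3)]] v(3) by (auto simp: edges_def adj_def)
  then show "e \<in> (\<Union>i\<in>{0,1,2}. map_prod (F i) (F i) ` edges m)"
    using e(1) xy(3,4) v(2) by (intro UN_I[of i] image_eqI) auto
next
  fix e assume "e \<in> (\<Union>i\<in>{0,1,2}. map_prod (F i) (F i) ` edges m)"
  then obtain i x y w where i: "i \<in> {0,1,2}" and e: "e = (F i x, F i y)" "x \<in> V m" "y \<in> V m"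
    "x \<noteq> y" "w \<in> words m" "x \<in> Fw w ` SG" "y \<in> Fw w ` SG"
    by (force simp: edges_def adj_def)
  have "i # w \<in> words (Suc m)" using i e by (auto simp: words_Suc)
  moreover have "F i x \<in> Fw (i # w) ` SG" "F i y \<in> Fw (i # w) ` SG" using e by auto
  moreover have "F i x \<in> V (Suc m)" "F i y \<in> V (Suc m)" using i e by (auto simp: V_Suc)
  moreover have "F i x \<noteq> F i y" using e by (simp add: F_inject)
  ultimately have "adj (Suc m) (F i x) (F i y)" unfolding adj_def by blast
  then show "e \<in> edges (Suc m)" using e(1) by (simp add: edges_def)
qed

text \<open>Two different cells share at most one point, but an edge has two distinct ends.\<close>

lemma edges_disjoint:
  assumes i: "i \<in> {0,1,2}" and j: "j \<in> {0,1,2}" and "i \<noteq> j"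
  shows "map_prod (F i) (F i) ` edges m \<inter> map_prod (F j) (F j) ` edges m = {}"
proof (rule ccontr)
  assume "\<not> ?thesis"
  then obtain x y x' y' where xy: "(x,y) \<in> edges m" "(x',y') \<in> edges m"
    "F i x = F j x'" "F i y = F j y'"
    by auto
  then have "x = q j" "y = q j"
    using F_meet[OF assms] edges_SG by blast+
  then show False using xy by (simp add: edges_def adj_def)
qed

lemma graph_energy_edges:
  "graph_energy m u v = (5/3) ^ m * ((1/2) * (\<Sum>(x,y)\<in>edges m. (u x - u y) * (v x - v y)))"
  by (simp add: graph_energy_def edges_def power_divide field_simps)

text \<open>The edges split into disjoint copies under the three maps, and the renormalization
  contributes one factor 5/3. Monotonicity, gluing and reflection invariance all rest on this
  identity.\<close>

lemma graph_energy_Suc: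
  "graph_energy (Suc m) u v = 5/3 * (\<Sum>i\<in>{0,1,2}. graph_energy m (u \<circ> F i) (v \<circ> F i))"
proof -
  have "(\<Sum>(x,y)\<in>edges (Suc m). (u x - u y) * (v x - v y)) =
    (\<Sum>i\<in>{0,1,2}. \<Sum>(x,y)\<in>map_prod (F i) (F i) ` edges m. (u x - u y) * (v x - v y))"
    unfolding edges_Suc
  proof (rule sum.UNION_disjoint)
    show "\<forall>i\<in>{0,1,2}. finite (map_prod (F i) (F i) ` edges m)"
      using finite_edges by blast
    show "\<forall>i\<in>{0,1,2}. \<forall>j\<in>{0,1,2}. i \<noteq> j \<longrightarrow>
        map_prod (F i) (F i) ` edges m \<inter> map_prod (F j) (F j) ` edges m = {}"
      by (intro ballI impI edges_disjoint)
  qed simp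
  also have "\<dots> = (\<Sum>i\<in>{0,1,2}. \<Sum>(x,y)\<in>edges m. (u (F i x) - u (F i y)) * (v (F i x) - v (F i y)))"
  proof (rule sum.cong[OF refl])
    fix i
    have "inj_on (map_prod (F i) (F i)) (edges m)"
      by (auto simp: inj_on_def F_inject)
    then show "(\<Sum>(x,y)\<in>map_prod (F i) (F i) ` edges m. (u x - u y) * (v x - v y)) =
      (\<Sum>(x,y)\<in>edges m. (u (F i x) - u (F i y)) * (v (F i x) - v (F i y)))"
      by (simp add: sum.reindex split_def)
  qed
  finally show ?thesis
    unfolding graph_energy_edges by (simp add: sum_distrib_left algebra_simps)
qed

lemma q_distinct: "q 0 \<noteq> q 1" "q 0 \<noteq> q 2" "q 1 \<noteq> q 2"
  using bary_q[of 0 0] bary_q[of 0 1] bary_q[of 0 2] bary_q[of 1 1] bary_q[of 1 2] by auto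

lemma graph_energy_0:
  "graph_energy 0 u v = (u (q 0) - u (q 1)) * (v (q 0) - v (q 1)) +
     (u (q 1) - u (q 2)) * (v (q 1) - v (q 2)) + (u (q 2) - u (q 0)) * (v (q 2) - v (q 0))"
proof -
  have "edges 0 = {(q 0,q 1),(q 1,q 0),(q 0,q 2),(q 2,q 0),(q 1,q 2),(q 2,q 1)}"
    using q_distinct by (auto simp: edges_0 V_0)
  then show ?thesis
    using q_distinct by (simp add: graph_energy_edges) (simp add: algebra_simps)
qed

lemma graph_energy_add_left: "graph_energy m (\<lambda>x. u x + u' x) v = graph_energy m u v + graph_energy m u' v"
  by (simp add: graph_energy_edges split_def algebra_simps sum.distrib sum_subtractf)

lemma graph_energy_scale_left: "graph_energy m (\<lambda>x. c * u x) v = c * graph_energy m u v"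
  by (simp add: graph_energy_edges split_def algebra_simps sum_distrib_left)

lemma graph_energy_cong:
  assumes "\<And>x. x \<in> SG \<Longrightarrow> u x = u' x" "\<And>x. x \<in> SG \<Longrightarrow> v x = v' x"
  shows "graph_energy m u v = graph_energy m u' v'"
proof -
  have "(\<Sum>(x,y)\<in>edges m. (u x - u y) * (v x - v y)) = (\<Sum>(x,y)\<in>edges m. (u' x - u' y) * (v' x - v' y))"
    using edges_SG assms by (intro sum.cong) auto
  then show ?thesis unfolding graph_energy_edges by simp
qed

text \<open>The renormalization factor 5/3 is the one for which minimizing the energy over the three
  midpoints reproduces the energy of the boundary values.\<close>

lemma graph_energy_mono1: "graph_energy 0 u u \<le> graph_energy 1 u u"
proof -
  have ineq: "(a-b)^2 + (b-c)^2 + (c-a)^2 \<le> 5/3 *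
     (((a-x)^2+(x-y)^2+(y-a)^2) + ((x-b)^2+(b-z)^2+(z-x)^2) + ((y-z)^2+(z-c)^2+(c-y)^2))"
    for a b c x y z :: real
  proof -
    \<comment> \<open>Deviations of the midpoint values from the minimizer, the harmonic extension
      by the 2/5-2/5-1/5 rule. Completing the square at the minimizer leaves no cross terms, and the
      excess is the energy of the deviations with zero boundary values.\<close>
    let ?X = "x - (2*a+2*b+c)/5" and ?Y = "y - (2*a+b+2*c)/5" and ?Z = "z - (a+2*b+2*c)/5"
    have "5/3 * (((a-x)^2+(x-y)^2+(y-a)^2) + ((x-b)^2+(b-z)^2+(z-x)^2) + ((y-z)^2+(z-c)^2+(c-y)^2))
      = (a-b)^2 + (b-c)^2 + (c-a)^2 +
        5/3 * (2*?X^2 + 2*?Y^2 + 2*?Z^2 + (?X-?Y)^2 + (?Y-?Z)^2 + (?Z-?X)^2)"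
      by (simp add: field_simps power2_eq_square)
    then show ?thesis by (simp add: add_nonneg_nonneg)
  qed
  have "graph_energy 0 u u \<le> graph_energy (Suc 0) u u"
    using ineq[of "u (q 0)" "u (q 1)" "u (q 2)" "u (F 0 (q 1))" "u (F 0 (q 2))" "u (F 1 (q 2))"]
    by (simp add: graph_energy_Suc graph_energy_0 F_q_self F_q_swap[of 1 0]
      F_q_swap[of 2 0] F_q_swap[of 2 1] power2_eq_square del: One_nat_def)
  then show ?thesis by simp
qed

lemma graph_energy_mono: "graph_energy m u u \<le> graph_energy (Suc m) u u"
proof (induction m arbitrary: u)
  case 0
  then show ?case using graph_energy_mono1 by simp
next
  case (Suc m)
  show ?case unfolding graph_energy_Suc[of "Suc m"] graph_energy_Suc[of m]
    by (intro mult_left_mono sum_mono Suc[unfolded graph_energy_Suc[of m]]) simp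
qed

section \<open>The domain of the energy\<close>

text \<open>Monotonicity turns existence of the limit into boundedness, so membership in the domain
  can be proved by inequalities alone.\<close>

lemma dom_energy_iff:
  "u \<in> dom_energy \<longleftrightarrow> continuous_on SG u \<and> (\<exists>B. \<forall>m. graph_energy m u u \<le> B)"
proof -
  have "(\<exists>e. has_energy u u e) \<longleftrightarrow> (\<exists>B. \<forall>m. graph_energy m u u \<le> B)"
  proof
    assume "\<exists>e. has_energy u u e"
    then have "Bseq (\<lambda>m. graph_energy m u u)"
      unfolding has_energy_def using convergent_imp_Bseq by (auto simp: convergent_def)
    then show "\<exists>B. \<forall>m. graph_energy m u u \<le> B"
      by (metis Bseq_def real_norm_def abs_le_D1)
  next
    assume "\<exists>B. \<forall>m. graph_energy m u u \<le> B"
    then obtain B where B: "\<And>m. graph_energy m u u \<le> B" by blast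
    have "incseq (\<lambda>m. graph_energy m u u)"
      by (rule incseq_SucI) (rule graph_energy_mono)
    then show "\<exists>e. has_energy u u e"
      unfolding has_energy_def using B by (meson incseq_convergent)
  qed
  then show ?thesis by (simp add: dom_energy_def)
qed

lemma dom_energy_cont: "u \<in> dom_energy \<Longrightarrow> continuous_on SG u"
  by (simp add: dom_energy_def)

lemma continuous_SG_bound:
  fixes u :: "real^2 \<Rightarrow> real"
  assumes "continuous_on SG u"
  obtains M where "M \<ge> 0" "\<And>x. x \<in> SG \<Longrightarrow> \<bar>u x\<bar> \<le> M"
proof -
  have "bounded (u ` SG)"
    using assms compact_SG by (intro compact_imp_bounded compact_continuous_image)
  then obtain M where "\<And>x. x \<in> SG \<Longrightarrow> \<bar>u x\<bar> \<le> M" unfolding bounded_iff by auto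
  then show thesis using that[of "max M 0"] by (auto simp: le_max_iff_disj)
qed

text \<open>Each edge contributes a squared increment, so a bound between squared increments passes
  to the energies of every level with the same constants. Sums and products are the
  applications.\<close>

lemma dom_energy_dominated:
  assumes "u \<in> dom_energy" "v \<in> dom_energy" "continuous_on SG w"
    and "\<And>x y. x \<in> SG \<Longrightarrow> y \<in> SG \<Longrightarrow> (w x - w y)\<^sup>2 \<le> A * (u x - u y)\<^sup>2 + B * (v x - v y)\<^sup>2"
    and "A \<ge> 0" "B \<ge> 0"
  shows "w \<in> dom_energy"
proof -
  have *: "graph_energy m w w \<le> A * graph_energy m u u + B * graph_energy m v v" for m
  proof -
    have "(\<Sum>(x,y)\<in>edges m. (w x - w y) * (w x - w y)) \<le>
      (\<Sum>(x,y)\<in>edges m. A * ((u x - u y) * (u x - u y)) + B * ((v x - v y) * (v x - v y)))"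
      using edges_SG assms(4) by (intro sum_mono) (force simp: power2_eq_square)
    also have "\<dots> = A * (\<Sum>(x,y)\<in>edges m. (u x - u y) * (u x - u y)) +
      B * (\<Sum>(x,y)\<in>edges m. (v x - v y) * (v x - v y))"
      by (simp add: split_def sum.distrib sum_distrib_left)
    finally have "(5/3) ^ m * (1/2) * (\<Sum>(x,y)\<in>edges m. (w x - w y) * (w x - w y)) \<le>
      (5/3) ^ m * (1/2) * (A * (\<Sum>(x,y)\<in>edges m. (u x - u y) * (u x - u y)) +
      B * (\<Sum>(x,y)\<in>edges m. (v x - v y) * (v x - v y)))"
      by (rule mult_left_mono) simp
    then show ?thesis
      unfolding graph_energy_edges by (simp only: distrib_left mult_ac)
  qed
  obtain C where "\<And>m. graph_energy m u u \<le> C" using assms(1) unfolding dom_energy_iff by blast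
  moreover obtain D where "\<And>m. graph_energy m v v \<le> D" using assms(2) unfolding dom_energy_iff by blast
  ultimately have "graph_energy m w w \<le> A * C + B * D" for m
    using * assms(5,6) by (meson add_mono mult_left_mono order_trans)
  then show ?thesis using assms(3) unfolding dom_energy_iff by blast
qed

lemma square_add_le: "(a + b)\<^sup>2 \<le> 2 * a\<^sup>2 + 2 * (b::real)\<^sup>2"
  using zero_le_power2[of "a - b"] by (simp add: power2_eq_square algebra_simps)

lemma dom_energy_add:
  assumes "u \<in> dom_energy" "v \<in> dom_energy"
  shows "(\<lambda>x. u x + v x) \<in> dom_energy"
proof (rule dom_energy_dominated[OF assms, of _ 2 2])
  show "continuous_on SG (\<lambda>x. u x + v x)"
    using assms by (intro continuous_intros dom_energy_cont)
  show "(u x + v x - (u y + v y))\<^sup>2 \<le> 2 * (u x - u y)\<^sup>2 + 2 * (v x - v y)\<^sup>2" for x y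
    using square_add_le[of "u x - u y" "v x - v y"] by (simp add: algebra_simps)
qed auto

lemma dom_energy_const: "(\<lambda>x. c) \<in> dom_energy"
  unfolding dom_energy_iff by (auto simp: graph_energy_edges intro!: exI[of _ 0])

lemma dom_energy_mult:
  assumes "u \<in> dom_energy" "v \<in> dom_energy"
  shows "(\<lambda>x. u x * v x) \<in> dom_energy"
proof -
  obtain M where M: "M \<ge> 0" "\<And>x. x \<in> SG \<Longrightarrow> \<bar>u x\<bar> \<le> M"
    using continuous_SG_bound[OF dom_energy_cont[OF assms(1)]] by blast
  obtain N where N: "N \<ge> 0" "\<And>x. x \<in> SG \<Longrightarrow> \<bar>v x\<bar> \<le> N"
    using continuous_SG_bound[OF dom_energy_cont[OF assms(2)]] by blast
  show ?thesis
  proof (rule dom_energy_dominated[OF assms, of _ "2 * N\<^sup>2" "2 * M\<^sup>2"])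
    show "continuous_on SG (\<lambda>x. u x * v x)"
      using assms by (intro continuous_intros dom_energy_cont)
    fix x y assume xy: "x \<in> SG" "y \<in> SG"
    have "(u x * v x - u y * v y)\<^sup>2 = ((u x - u y) * v y + u x * (v x - v y))\<^sup>2"
      by (simp add: algebra_simps)
    also have "\<dots> \<le> 2 * ((u x - u y) * v y)\<^sup>2 + 2 * (u x * (v x - v y))\<^sup>2"
      by (rule square_add_le)
    also have "\<dots> \<le> 2 * (N\<^sup>2 * (u x - u y)\<^sup>2) + 2 * (M\<^sup>2 * (v x - v y)\<^sup>2)"
    proof -
      have "(v y)\<^sup>2 \<le> N\<^sup>2" "(u x)\<^sup>2 \<le> M\<^sup>2"
        using abs_le_square_iff[of "v y" N] abs_le_square_iff[of "u x" M] M N xy by auto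
      then have "(v y)\<^sup>2 * (u x - u y)\<^sup>2 \<le> N\<^sup>2 * (u x - u y)\<^sup>2"
        "(u x)\<^sup>2 * (v x - v y)\<^sup>2 \<le> M\<^sup>2 * (v x - v y)\<^sup>2"
        by (intro mult_right_mono; simp)+
      then show ?thesis by (simp add: power_mult_distrib mult.commute)
    qed
    finally show "(u x * v x - u y * v y)\<^sup>2 \<le> 2 * N\<^sup>2 * (u x - u y)\<^sup>2 + 2 * M\<^sup>2 * (v x - v y)\<^sup>2"
      by simp
  qed auto
qed

lemma dom_energy_scale: "u \<in> dom_energy \<Longrightarrow> (\<lambda>x. c * u x) \<in> dom_energy"
  using dom_energy_mult[OF dom_energy_const] by blast

section \<open>Transplanting functions into cells\<close>

text \<open>At a point shared with another cell the two prescriptions agree: by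
  \<open>F_meet\<close> it is the image of a boundary point, where \<phi> is 0. Only one cell
  carries energy, so the bound on the energies grows just by the factor 5/3.\<close>

lemma dom_energy_glue:
  assumes i: "i \<in> {0,1,2}" and \<phi>: "\<phi> \<in> dom_energy" and \<phi>0: "\<And>x. x \<in> V 0 \<Longrightarrow> \<phi> x = 0"
  obtains \<psi> where "\<psi> \<in> dom_energy" "\<And>x. x \<in> V 0 \<Longrightarrow> \<psi> x = 0"
    "\<And>x. x \<in> SG \<Longrightarrow> \<psi> (F i x) = \<phi> x" "\<And>x. x \<notin> F i ` SG \<Longrightarrow> \<psi> x = 0"
proof -
  \<comment> \<open>\<open>2 *\<^sub>R x - q i\<close> inverts \<open>F i\<close>. The default 0
    also covers points off \<open>SG\<close>, as the last conclusion demands.\<close>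
  define \<psi> where "\<psi> x = (if x \<in> F i ` SG then \<phi> (2 *\<^sub>R x - q i) else 0)" for x
  have inv: "2 *\<^sub>R F i x - q i = x" for x by (simp add: F_alt scaleR_add_right)
  have 1: "\<psi> (F i x) = \<phi> x" if "x \<in> SG" for x
    using that by (simp add: \<psi>_def inv)
  have 2: "\<psi> (F j x) = 0" if "x \<in> SG" "j \<in> {0,1,2}" "j \<noteq> i" for x j
  proof (cases "F j x \<in> F i ` SG")
    case True
    then obtain y where y: "y \<in> SG" "F i y = F j x" by force
    then have "y = q j" using F_meet[OF i that(2) _ y(1) that(1)] that(3) by simp
    then have "\<phi> y = 0" using \<phi>0 that(2) by (auto simp: V_0)
    then show ?thesis using 1[OF y(1)] y(2) by simp
  qed (simp add: \<psi>_def)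
  have cont: "continuous_on (F j ` SG) \<psi>" if j: "j \<in> {0,1,2}" for j
  proof (cases "j = i")
    case True
    have "continuous_on (F i ` SG) (\<lambda>x. \<phi> (2 *\<^sub>R x - q i))"
      by (rule continuous_on_compose2[OF dom_energy_cont[OF \<phi>]])
         (auto simp: inv intro!: continuous_intros)
    then show ?thesis
      unfolding True by (rule continuous_on_eq) (simp add: \<psi>_def)
  next
    case False
    have "continuous_on (F j ` SG) (\<lambda>_. 0::real)" by simp
    then show ?thesis by (rule continuous_on_eq) (use 2[OF _ j False] in auto)
  qed
  have closed: "closed (F j ` SG)" for j
    using compact_SG by (intro compact_imp_closed compact_continuous_image continuous_on_F)
  have "continuous_on (F 0 ` SG \<union> F 1 ` SG \<union> F 2 ` SG) \<psi>"
    by (intro continuous_on_closed_Un closed_Un closed cont) auto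
  then have cont\<psi>: "continuous_on SG \<psi>" using SG_eq by simp
  obtain B where B: "\<And>m. graph_energy m \<phi> \<phi> \<le> B" using \<phi> unfolding dom_energy_iff by blast
  have E: "graph_energy (Suc m) \<psi> \<psi> \<le> 5/3 * B" for m
  proof -
    have "graph_energy m (\<psi> \<circ> F j) (\<psi> \<circ> F j) = (if j = i then graph_energy m \<phi> \<phi> else 0)"
      if j: "j \<in> {0,1,2}" for j
    proof (cases "j = i")
      case True
      then show ?thesis using 1 by (auto intro!: graph_energy_cong)
    next
      case False
      then have "graph_energy m (\<psi> \<circ> F j) (\<psi> \<circ> F j) = graph_energy m (\<lambda>x. 0) (\<lambda>x. 0)"
        using 2[OF _ j] by (intro graph_energy_cong) auto
      then show ?thesis using False by (simp add: graph_energy_edges)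
    qed
    then have "graph_energy (Suc m) \<psi> \<psi> = 5/3 * (\<Sum>j\<in>{0,1,2}. if j = i then graph_energy m \<phi> \<phi> else 0)"
      unfolding graph_energy_Suc by simp
    also have "\<dots> = 5/3 * graph_energy m \<phi> \<phi>" using i by auto
    finally show ?thesis using B by simp
  qed
  \<comment> \<open>Self-similarity bounds successor levels only; monotonicity adds level 0.\<close>
  have "graph_energy m \<psi> \<psi> \<le> 5/3 * B" for m
    using E[of m] graph_energy_mono[of m \<psi>] by linarith
  then have "\<psi> \<in> dom_energy" using cont\<psi> unfolding dom_energy_iff by blast
  moreover have "\<psi> x = 0" if "x \<in> V 0" for x
  proof -
    obtain j where j: "j \<in> {0,1,2}" "x = q j" using \<open>x \<in> V 0\<close> by (auto simp: V_0)
    show ?thesis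
    proof (cases "j = i")
      case True
      then show ?thesis using 1[OF q_SG[OF j(1)]] \<phi>0[OF that] j(2) by (simp add: F_q_self)
    next
      case False
      then show ?thesis using 2[OF q_SG[OF j(1)] j(1)] j(2) by (simp add: F_q_self)
    qed
  qed
  ultimately show thesis using that 1 \<psi>_def by auto
qed

text \<open>One application of \<open>dom_energy_glue\<close> per letter. Copies in arbitrarily
  small cells are the test functions that detect a Laplacian pointwise.\<close>

lemma dom_energy_glue_word:
  assumes "w \<in> words m" and "\<phi> \<in> dom_energy" and "\<And>x. x \<in> V 0 \<Longrightarrow> \<phi> x = 0"
  shows "\<exists>\<psi>\<in>dom_energy. (\<forall>x\<in>V 0. \<psi> x = 0) \<and> (\<forall>x\<in>SG. \<psi> (Fw w x) = \<phi> x) \<and>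
    (\<forall>x. x \<notin> Fw w ` SG \<longrightarrow> \<psi> x = 0)"
  using assms(1)
proof (induction m arbitrary: w)
  case 0
  define \<psi> where "\<psi> x = (if x \<in> SG then \<phi> x else 0)" for x
  have "continuous_on SG \<psi>"
    by (rule continuous_on_eq[OF dom_energy_cont[OF assms(2)]]) (simp add: \<psi>_def)
  moreover have "graph_energy m \<psi> \<psi> = graph_energy m \<phi> \<phi>" for m
    by (rule graph_energy_cong) (auto simp: \<psi>_def)
  ultimately have "\<psi> \<in> dom_energy" using assms(2) by (simp add: dom_energy_iff)
  then show ?case using 0 assms(3) by (intro bexI[of _ \<psi>]) (auto simp: words_0 \<psi>_def)
next
  case (Suc m)
  obtain i v where w: "w = i # v" "i \<in> {0,1,2}" "v \<in> words m"
    using Suc.prems by (auto simp: words_Suc)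
  obtain \<psi> where \<psi>: "\<psi> \<in> dom_energy" "\<And>x. x \<in> V 0 \<Longrightarrow> \<psi> x = 0"
    "\<And>x. x \<in> SG \<Longrightarrow> \<psi> (Fw v x) = \<phi> x" "\<And>x. x \<notin> Fw v ` SG \<Longrightarrow> \<psi> x = 0"
    using Suc.IH[OF w(3)] by blast
  obtain \<theta> where \<theta>: "\<theta> \<in> dom_energy" "\<And>x. x \<in> V 0 \<Longrightarrow> \<theta> x = 0"
    "\<And>x. x \<in> SG \<Longrightarrow> \<theta> (F i x) = \<psi> x" "\<And>x. x \<notin> F i ` SG \<Longrightarrow> \<theta> x = 0"
    using dom_energy_glue[OF w(2) \<psi>(1,2)] by blast
  have "\<theta> x = 0" if "x \<notin> Fw w ` SG" for x
  proof (cases "x \<in> F i ` SG")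
    case True
    then obtain y where y: "y \<in> SG" "x = F i y" by blast
    then have "y \<notin> Fw v ` SG" using that w(1) by auto
    then show ?thesis using \<psi>(4) \<theta>(3) y by simp
  qed (rule \<theta>(4))
  then show ?case using \<theta>(1,2,3) \<psi>(3) Fw_SG[OF w(3)] w(1)
    by (intro bexI[of _ \<theta>]) auto
qed

section \<open>Reflection and measure\<close>

text \<open>Reflection of the plane in the vertical line through \<open>q 0\<close>;
  \<open>flipi\<close> is the permutation it induces on the indices of boundary points and
  maps.\<close>

definition flip :: "real^2 \<Rightarrow> real^2" where
  "flip x = vector [1 - x$1, x$2]"

definition flipi :: "nat \<Rightarrow> nat" where
  "flipi i = (if i = 1 then 2 else if i = 2 then 1 else i)"

lemma flipi_flipi [simp]: "flipi (flipi i) = i"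
  by (simp add: flipi_def)

lemma flipi_012: "i \<in> {0,1,2} \<Longrightarrow> flipi i \<in> {0,1,2}"
  by (auto simp: flipi_def)

lemma flip_nth [simp]: "flip x $ 1 = 1 - x$1" "flip x $ 2 = x$2"
  by (simp_all add: flip_def)

lemma flip_flip [simp]: "flip (flip x) = x"
  by (simp add: vec_eq_iff forall_2)

lemma flip_q:
  assumes "i \<in> {0,1,2}"
  shows "flip (q i) = q (flipi i)"
proof -
  have "i = 0 \<or> i = 1 \<or> i = 2" using assms by auto
  then show ?thesis
    by (elim disjE) (simp_all add: vec_eq_iff forall_2 q_coords flipi_def del: One_nat_def)
qed

lemma flip_F:
  assumes "i \<in> {0,1,2}"
  shows "flip (F i x) = F (flipi i) (flip x)"
  unfolding F_alt flip_q[OF assms, symmetric]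
  by (simp add: vec_eq_iff forall_2 field_simps)

lemma continuous_on_flip: "continuous_on A flip"
proof -
  have "flip = (\<lambda>x. vector [1, 0] + x$1 *\<^sub>R vector [-1, 0] + x$2 *\<^sub>R vector [0, 1])"
    by (rule ext) (simp add: vec_eq_iff forall_2)
  then show ?thesis by (rule ssubst) (intro continuous_intros)
qed

text \<open>The mirror image satisfies the defining equation with the maps permuted, so it is again
  a gasket, and gaskets are unique.\<close>

lemma flip_SG: "x \<in> SG \<Longrightarrow> flip x \<in> SG"
proof -
  have "flip ` SG = (\<Union>i\<in>{0,1,2}. flip ` F i ` SG)"
    using arg_cong[OF is_gasketD(3)[OF is_gasket_SG], of "image flip"] unfolding image_UN ..
  also have "\<dots> = (\<Union>i\<in>{0,1,2}. F (flipi i) ` flip ` SG)"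
    by (rule SUP_cong) (auto simp: image_image flip_F)
  also have "\<dots> = (\<Union>i\<in>flipi ` {0,1,2}. F i ` flip ` SG)"
    by (simp only: image_image)
  also have "flipi ` {0,1,2} = {0,1,2}"
    by (auto simp: flipi_def)
  finally have "is_gasket (flip ` SG)"
    unfolding is_gasket_def
    using compact_continuous_image[OF continuous_on_flip compact_SG] SG_ne by blast
  then have "flip ` SG \<subseteq> SG" by (rule gasket_subset[OF _ is_gasket_SG])
  then show "x \<in> SG \<Longrightarrow> flip x \<in> SG" by blast
qed

lemma flip_Fw:
  "w \<in> words m \<Longrightarrow> flip (Fw w x) = Fw (map flipi w) (flip x)"
  by (induction m arbitrary: w) (auto simp: words_0 words_Suc flip_F)

lemma map_flipi_words:
  assumes "w \<in> words m"
  shows "map flipi w \<in> words m"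
proof -
  have w: "set w \<subseteq> {0,1,2}" "length w = m" using assms by (simp_all add: words_def)
  have "flipi ` set w \<subseteq> {0,1,2}"
    by (rule image_subsetI, rule flipi_012, rule subsetD[OF w(1)])
  then show ?thesis using w(2) by (simp add: words_def)
qed

lemma flip_V0: "x \<in> V 0 \<Longrightarrow> flip x \<in> V 0"
  unfolding V_0 using flip_q[of 0] flip_q[of 1] flip_q[of 2] by (auto simp: flipi_def)

text \<open>The reflection permutes the three cells and acts inside each as a reflection again, so
  self-similarity reduces the claim to the triangle \<open>V 0\<close>.\<close>

lemma graph_energy_flip: "graph_energy m (u \<circ> flip) (v \<circ> flip) = graph_energy m u v"
proof (induction m arbitrary: u v)
  case 0
  then show ?case
    by (simp add: graph_energy_0 flip_q flipi_def del: One_nat_def) (simp add: algebra_simps)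
next
  case (Suc m)
  have "(w \<circ> flip) \<circ> F i = (w \<circ> F (flipi i)) \<circ> flip" if "i \<in> {0,1,2}" for w :: "real^2 \<Rightarrow> real" and i
    using that by (auto simp: flip_F)
  then have "graph_energy m ((u \<circ> flip) \<circ> F i) ((v \<circ> flip) \<circ> F i) =
      graph_energy m (u \<circ> F (flipi i)) (v \<circ> F (flipi i))" if "i \<in> {0,1,2}" for i
    using that Suc[of "u \<circ> F (flipi i)" "v \<circ> F (flipi i)"] by (simp only:)
  then have "graph_energy (Suc m) (u \<circ> flip) (v \<circ> flip) =
      5/3 * (\<Sum>i\<in>{0,1,2}. graph_energy m (u \<circ> F (flipi i)) (v \<circ> F (flipi i)))"
    unfolding graph_energy_Suc by (simp only: cong: sum.cong)
  also have "(\<Sum>i\<in>{0,1,2}. graph_energy m (u \<circ> F (flipi i)) (v \<circ> F (flipi i))) =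
      (\<Sum>i\<in>{0,1,2}. graph_energy m (u \<circ> F i) (v \<circ> F i))"
    by (simp add: flipi_def)
  finally show ?case unfolding graph_energy_Suc .
qed

lemma continuous_on_SG_flip:
  fixes u :: "real^2 \<Rightarrow> real"
  shows "continuous_on SG u \<Longrightarrow> continuous_on SG (u \<circ> flip)"
  unfolding comp_def
  by (rule continuous_on_compose2[OF _ continuous_on_flip]) (auto intro: flip_SG)

lemma dom_energy_flip: "u \<in> dom_energy \<Longrightarrow> u \<circ> flip \<in> dom_energy"
  unfolding dom_energy_iff graph_energy_flip using continuous_on_SG_flip by blast

section \<open>Cells of small diameter\<close>

lemma small_cell:
  assumes "\<delta> > 0"
  shows "\<forall>\<^sub>F m in sequentially. \<forall>w\<in>words m. \<forall>x\<in>SG. \<forall>y\<in>SG. dist (Fw w x) (Fw w y) < \<delta>"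
proof -
  obtain D where D: "\<And>x y. x \<in> SG \<Longrightarrow> y \<in> SG \<Longrightarrow> dist x y \<le> D"
    using compact_imp_bounded[OF compact_SG] unfolding bounded_two_points by blast
  have "(\<lambda>m. D / 2 ^ m) \<longlonglongrightarrow> 0" by real_asymp
  then have "\<forall>\<^sub>F m in sequentially. D / 2 ^ m < \<delta>"
    using assms by (rule order_tendstoD)
  then show ?thesis
  proof (rule eventually_mono, intro ballI)
    fix m w x y assume m: "D / 2 ^ m < \<delta>" and w: "w \<in> words m" and "x \<in> SG" "y \<in> SG"
    then have "dist x y / 2 ^ m \<le> D / 2 ^ m" by (intro divide_right_mono D) auto
    moreover have "length w = m" using w by (simp add: words_def)
    ultimately show "dist (Fw w x) (Fw w y) < \<delta>" using m by (simp add: dist_Fw)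
  qed
qed

text \<open>The cell need not be a neighbourhood of \<open>z\<close>, which may be one of its
  corners. It suffices later that the cell is small and has positive measure.\<close>

lemma cell_neighbourhood:
  assumes "z \<in> SG" "\<delta> > 0"
  shows "\<exists>m. \<exists>w\<in>words m. z \<in> Fw w ` SG \<and> (\<forall>x\<in>Fw w ` SG. dist x z < \<delta>)"
proof -
  obtain m where m: "\<And>w x y. w \<in> words m \<Longrightarrow> x \<in> SG \<Longrightarrow> y \<in> SG \<Longrightarrow> dist (Fw w x) (Fw w y) < \<delta>"
    using small_cell[OF assms(2)] unfolding eventually_sequentially by blast
  obtain w where w: "w \<in> words m" "z \<in> Fw w ` SG" using assms(1) SG_words[of m] by blast
  have "\<forall>x\<in>Fw w ` SG. dist x z < \<delta>" using w m by auto
  then show ?thesis using w by blast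
qed

lemma continuous_on_Fw: "continuous_on A (Fw w)"
proof (induction w)
  case (Cons i w)
  show ?case
    unfolding Fw.simps by (rule continuous_on_compose[OF Cons continuous_on_F])
qed (simp add: continuous_on_id)

lemma Fw_SG_closed: "closed (Fw w ` SG)"
  using compact_SG by (intro compact_imp_closed compact_continuous_image continuous_on_Fw)

lemma Fw_SG_subset: "w \<in> words m \<Longrightarrow> Fw w ` SG \<subseteq> SG"
  using Fw_SG by blast

section \<open>Integration against the self-similar measure\<close>

locale sg_measure =
  fixes \<mu> :: "(real^2) measure"
  assumes sg: "is_SG_measure \<mu>"
begin

sublocale prob_space \<mu>
  using sg by (simp add: is_SG_measure_def)

lemma sets_eq [measurable_cong]: "sets \<mu> = sets borel"
  using sg by (simp add: is_SG_measure_def)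

lemma space_eq [simp]: "space \<mu> = UNIV"
  using sets_eq_imp_space_eq[OF sets_eq] by simp

lemma measure_cell: "w \<in> words m \<Longrightarrow> measure \<mu> (Fw w ` SG) = (1/3) ^ m"
  using sg by (simp add: is_SG_measure_def)

lemma measure_SG: "measure \<mu> SG = 1"
  using measure_cell[of "[]" 0] by (simp add: words_0)

lemma cell_sets [measurable]: "Fw w ` SG \<in> sets \<mu>"
  unfolding sets_eq using Fw_SG_closed by (rule borel_closed)

lemma SG_sets [measurable]: "SG \<in> sets \<mu>"
  using cell_sets[of "[]"] by simp

lemma cont_set_integrable:
  fixes f :: "real^2 \<Rightarrow> real"
  assumes "continuous_on SG f"
  shows "set_integrable \<mu> SG f"
proof -
  obtain M where M: "M \<ge> 0" "\<And>x. x \<in> SG \<Longrightarrow> \<bar>f x\<bar> \<le> M"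
    using continuous_SG_bound[OF assms] by blast
  have "(\<lambda>x. indicator SG x *\<^sub>R f x) \<in> borel_measurable borel"
    using SG_sets unfolding sets_eq by (intro borel_measurable_continuous_on_indicator assms) auto
  then have "(\<lambda>x. indicator SG x *\<^sub>R f x) \<in> borel_measurable \<mu>"
    using measurable_cong_sets[OF sets_eq refl] by blast
  then show ?thesis
    unfolding set_integrable_def
    by (rule integrable_const_bound[of _ M, rotated]) (use M in \<open>auto simp: indicator_def\<close>)
qed

lemma cont_set_integrable_cell:
  fixes f :: "real^2 \<Rightarrow> real"
  shows "continuous_on SG f \<Longrightarrow> w \<in> words m \<Longrightarrow> set_integrable \<mu> (Fw w ` SG) f"
  by (rule set_integrable_subset[OF cont_set_integrable cell_sets Fw_SG_subset])

lemma LINT_cong: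
  fixes f g :: "real^2 \<Rightarrow> real"
  assumes "\<And>x. x \<in> SG \<Longrightarrow> f x = g x"
  shows "(LINT x:SG|\<mu>. f x) = (LINT x:SG|\<mu>. g x)"
  by (rule set_lebesgue_integral_cong[OF SG_sets]) (use assms in auto)

text \<open>Overlaps are null without measuring them: the sum of the indicators dominates that of
  \<open>SG\<close>, and both integrate to 1, since there are \<open>3 ^ m\<close> cells of measure
  \<open>(1/3) ^ m\<close>.\<close>

lemma AE_cells: "AE x in \<mu>. (\<Sum>w\<in>words m. indicator (Fw w ` SG) x) = (indicator SG x :: real)"
proof -
  let ?N = "\<lambda>x. (\<Sum>w\<in>words m. indicator (Fw w ` SG) x) - (indicator SG x :: real)"
  have nn: "?N x \<ge> 0" for x
  proof (cases "x \<in> SG")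
    case True
    then obtain w where w: "w \<in> words m" "x \<in> Fw w ` SG" using SG_words[of m] by blast
    have "(indicator (Fw w ` SG) x :: real) \<le> (\<Sum>w\<in>words m. indicator (Fw w ` SG) x)"
      by (rule member_le_sum[OF w(1)]) (auto simp: finite_words)
    then show ?thesis using w True by simp
  next
    case False
    then show ?thesis by (simp add: sum_nonneg)
  qed
  have int: "integrable \<mu> ?N"
    by (intro Bochner_Integration.integrable_diff Bochner_Integration.integrable_sum
        integrable_real_indicator) (auto simp: emeasure_eq_measure)
  have "(LINT x|\<mu>. ?N x) = (\<Sum>w\<in>words m. measure \<mu> (Fw w ` SG)) - measure \<mu> SG"
    by (subst Bochner_Integration.integral_diff)
       (auto intro!: Bochner_Integration.integrable_sum integrable_real_indicator
        simp: emeasure_eq_measure)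
  also have "\<dots> = 0"
    using measure_cell by (simp add: measure_SG card_words power_divide)
  finally have "AE x in \<mu>. ?N x = 0"
    using integral_nonneg_eq_0_iff_AE[OF int] nn by auto
  then show ?thesis by eventually_elim simp
qed

lemma LINT_cells:
  fixes f :: "real^2 \<Rightarrow> real"
  assumes f: "continuous_on SG f"
  shows "(LINT x:SG|\<mu>. f x) = (\<Sum>w\<in>words m. LINT x:Fw w ` SG|\<mu>. f x)"
proof -
  let ?g = "\<lambda>x. indicator SG x * f x"
  have g: "integrable \<mu> ?g" using cont_set_integrable[OF f] by (simp add: set_integrable_def)
  have ind: "indicator (Fw w ` SG) x * f x = indicator (Fw w ` SG) x * ?g x" if "w \<in> words m" for w x
    using Fw_SG_subset[OF that] by (auto simp: indicator_def)
  have "(LINT x|\<mu>. ?g x) = (LINT x|\<mu>. (\<Sum>w\<in>words m. indicator (Fw w ` SG) x * f x))"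
  proof (rule integral_cong_AE)
    show "?g \<in> borel_measurable \<mu>" using g by auto
    have *: "(\<lambda>x. indicator (Fw w ` SG) x * ?g x) \<in> borel_measurable \<mu>" for w
      by (intro borel_measurable_times borel_measurable_indicator cell_sets borel_measurable_integrable[OF g])
    show "(\<lambda>x. \<Sum>w\<in>words m. indicator (Fw w ` SG) x * f x) \<in> borel_measurable \<mu>"
      using * by (intro borel_measurable_sum) (simp only: ind)
    show "AE x in \<mu>. ?g x = (\<Sum>w\<in>words m. indicator (Fw w ` SG) x * f x)"
      using AE_cells[of m] by eventually_elim (simp flip: sum_distrib_right)
  qed
  also have "\<dots> = (\<Sum>w\<in>words m. LINT x|\<mu>. indicator (Fw w ` SG) x * f x)"
    using cont_set_integrable_cell[OF f]
    by (intro Bochner_Integration.integral_sum) (simp add: set_integrable_def)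
  finally show ?thesis by (simp add: set_lebesgue_integral_def)
qed

text \<open>Expresses the integral of a continuous function through the cell measures alone, which
  is how symmetry of the words becomes symmetry of the integral.\<close>

lemma riemann_sum:
  fixes f :: "real^2 \<Rightarrow> real"
  assumes f: "continuous_on SG f" and z: "z \<in> SG"
  shows "(\<lambda>m. (1/3) ^ m * (\<Sum>w\<in>words m. f (Fw w z))) \<longlonglongrightarrow> (LINT x:SG|\<mu>. f x)"
proof (rule LIMSEQ_I)
  fix e :: real assume e: "e > 0"
  have "uniformly_continuous_on SG f"
    using f compact_SG by (rule compact_uniformly_continuous)
  then obtain \<delta> where \<delta>: "\<delta> > 0" "\<And>x y. x \<in> SG \<Longrightarrow> y \<in> SG \<Longrightarrow> dist x y < \<delta> \<Longrightarrow> dist (f x) (f y) < e/2"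
    using e unfolding uniformly_continuous_on_def by (metis half_gt_zero)
  have "\<forall>\<^sub>F m in sequentially.
      norm ((1/3) ^ m * (\<Sum>w\<in>words m. f (Fw w z)) - (LINT x:SG|\<mu>. f x)) < e"
    using small_cell[OF \<delta>(1)]
  proof eventually_elim
    case (elim m)
    \<comment> \<open>The error on one cell is at most the oscillation e/2 times the measure of the
      cell; over all cells this adds up to e/2.\<close>
    have cell: "\<bar>(1/3) ^ m * f (Fw w z) - (LINT x:Fw w ` SG|\<mu>. f x)\<bar> \<le> e/2 * (1/3) ^ m"
      if w: "w \<in> words m" for w
    proof -
      let ?C = "Fw w ` SG"
      have c: "set_integrable \<mu> ?C (\<lambda>x. c)" for c :: real
        unfolding set_integrable_def
        using integrable_real_indicator[of ?C \<mu>] cell_sets by (auto simp: emeasure_eq_measure)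
      have "(1/3) ^ m * f (Fw w z) - (LINT x:?C|\<mu>. f x) = (LINT x:?C|\<mu>. f (Fw w z) - f x)"
        using set_integral_diff(2)[OF c cont_set_integrable_cell[OF f w], of "f (Fw w z)"]
          measure_cell[OF w] by (simp add: set_lebesgue_integral_def mult.commute)
      also have "\<bar>\<dots>\<bar> \<le> (LINT x:?C|\<mu>. \<bar>f (Fw w z) - f x\<bar>)"
        using set_integral_diff(1)[OF c cont_set_integrable_cell[OF f w], of "f (Fw w z)"]
        unfolding set_lebesgue_integral_def set_integrable_def
        by (intro order_trans[OF integral_abs_bound]) (simp add: abs_mult)
      also have "\<dots> \<le> (LINT x:?C|\<mu>. e/2)"
      proof (rule set_integral_mono)
        show "set_integrable \<mu> ?C (\<lambda>x. \<bar>f (Fw w z) - f x\<bar>)"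
          by (intro set_integrable_abs set_integral_diff(1) c cont_set_integrable_cell[OF f w])
        show "\<bar>f (Fw w z) - f x\<bar> \<le> e/2" if "x \<in> ?C" for x
        proof -
          obtain y where y: "y \<in> SG" "x = Fw w y" using \<open>x \<in> ?C\<close> by blast
          have "dist (Fw w z) x < \<delta>" using elim w z y by blast
          then have "dist (f (Fw w z)) (f x) < e/2"
            using \<delta>(2) Fw_SG[OF w] y z by blast
          then show ?thesis by (simp add: dist_real_def)
        qed
      qed (rule c)
      also have "\<dots> = e/2 * (1/3) ^ m"
        using measure_cell[OF w] by (simp add: set_lebesgue_integral_def)
      finally show ?thesis .
    qed
    have "\<bar>(1/3) ^ m * (\<Sum>w\<in>words m. f (Fw w z)) - (LINT x:SG|\<mu>. f x)\<bar> =
      \<bar>\<Sum>w\<in>words m. (1/3) ^ m * f (Fw w z) - (LINT x:Fw w ` SG|\<mu>. f x)\<bar>"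
      by (simp add: LINT_cells[OF f, of m] sum_distrib_left sum_subtractf)
    also have "\<dots> \<le> (\<Sum>w\<in>words m. e/2 * (1/3) ^ m)"
      by (rule order_trans[OF sum_abs sum_mono[OF cell]])
    also have "\<dots> < e" using e by (simp add: card_words power_divide)
    finally show ?case by simp
  qed
  then show "\<exists>M. \<forall>m\<ge>M. norm ((1/3) ^ m * (\<Sum>w\<in>words m. f (Fw w z)) - (LINT x:SG|\<mu>. f x)) < e"
    unfolding eventually_sequentially .
qed

text \<open>Sampling at the fixed point \<open>q 0\<close> makes the Riemann sums of both sides
  equal, because the reflection only permutes the words.\<close>

lemma LINT_flip:
  fixes f :: "real^2 \<Rightarrow> real"
  assumes f: "continuous_on SG f"
  shows "(LINT x:SG|\<mu>. f (flip x)) = (LINT x:SG|\<mu>. f x)"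
proof -
  have q0: "q 0 \<in> SG" "flip (q 0) = q 0" using q_SG[of 0] flip_q[of 0] by (simp_all add: flipi_def)
  have "(\<Sum>w\<in>words m. f (flip (Fw w (q 0)))) = (\<Sum>w\<in>words m. f (Fw w (q 0)))" for m
    by (rule sum.reindex_bij_witness[where i = "map flipi" and j = "map flipi"])
       (auto simp: flip_Fw q0 comp_def intro: map_flipi_words)
  then show ?thesis
    using riemann_sum[OF f q0(1)] riemann_sum[OF continuous_on_SG_flip[OF f] q0(1)]
    by (simp add: comp_def LIMSEQ_unique)
qed

text \<open>The measure has full support: a positive value persists on a small cell, and cells have
  positive measure.\<close>

lemma LINT_0_imp:
  fixes f :: "real^2 \<Rightarrow> real"
  assumes f: "continuous_on SG f" and nn: "\<And>x. x \<in> SG \<Longrightarrow> f x \<ge> 0"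
    and 0: "(LINT x:SG|\<mu>. f x) = 0" and z: "z \<in> SG"
  shows "f z = 0"
proof (rule ccontr)
  assume "f z \<noteq> 0"
  then have pos: "f z > 0" using nn[OF z] by simp
  then obtain \<delta> where \<delta>: "\<delta> > 0" "\<And>x. x \<in> SG \<Longrightarrow> dist x z < \<delta> \<Longrightarrow> dist (f x) (f z) < f z / 2"
    using f z unfolding continuous_on_iff by (metis half_gt_zero)
  obtain m w where w: "w \<in> words m" "z \<in> Fw w ` SG" "\<forall>x\<in>Fw w ` SG. dist x z < \<delta>"
    using cell_neighbourhood[OF z \<delta>(1)] by (elim exE bexE conjE)
  have big: "f x \<ge> f z / 2" if "x \<in> Fw w ` SG" for x
  proof -
    have "x \<in> SG" using Fw_SG_subset[OF w(1)] that by blast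
    then have "\<bar>f x - f z\<bar> < f z / 2" using \<delta>(2) bspec[OF w(3) that] by (simp add: dist_real_def)
    then show ?thesis unfolding abs_less_iff by (simp add: field_simps)
  qed
  have "(1/3) ^ m * (f z / 2) = (LINT x|\<mu>. indicator (Fw w ` SG) x * (f z / 2))"
    using measure_cell[OF w(1)] by simp
  also have "\<dots> \<le> (LINT x|\<mu>. indicator SG x * f x)"
  proof (rule integral_mono)
    show "integrable \<mu> (\<lambda>x. indicator (Fw w ` SG) x * (f z / 2))"
      using integrable_real_indicator[of "Fw w ` SG" \<mu>] by (auto simp: emeasure_eq_measure)
    show "integrable \<mu> (\<lambda>x. indicator SG x * f x)"
      using cont_set_integrable[OF f] by (simp add: set_integrable_def)
    show "indicator (Fw w ` SG) x * (f z / 2) \<le> indicator SG x * f x" for x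
      using big[of x] Fw_SG_subset[OF w(1)] nn[of x] by (auto simp: indicator_def)
  qed
  also have "\<dots> = 0" using 0 by (simp add: set_lebesgue_integral_def)
  finally have "(1/3) ^ m * (f z / 2) \<le> 0" .
  moreover have "(1/3) ^ m * (f z / 2) > 0" using pos by (intro mult_pos_pos) auto
  ultimately show False by linarith
qed

text \<open>The integrand is continuous on the compact set \<open>SG \<times> SG\<close>, hence
  bounded there, and Borel sets of the product are product-measurable; so it is integrable over the
  product.\<close>

lemma LINT_Fubini:
  fixes G :: "real^2 \<Rightarrow> real^2 \<Rightarrow> real" and f g :: "real^2 \<Rightarrow> real"
  assumes G: "continuous_on (SG \<times> SG) (\<lambda>(x,y). G x y)"
    and f: "continuous_on SG f" and g: "continuous_on SG g"
  shows "(LINT x:SG|\<mu>. (LINT y:SG|\<mu>. G x y * f y) * g x) =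
    (LINT y:SG|\<mu>. f y * (LINT x:SG|\<mu>. G x y * g x))"
proof -
  interpret P: pair_prob_space \<mu> \<mu> ..
  let ?h = "\<lambda>(x,y). G x y * f y * g x"
  have "continuous_on (SG \<times> SG) (\<lambda>z. (case z of (x,y) \<Rightarrow> G x y) * f (snd z) * g (fst z))"
    by (intro continuous_intros G continuous_on_compose2[OF f] continuous_on_compose2[OF g]) auto
  then have h: "continuous_on (SG \<times> SG) ?h" by (simp add: split_def)
  have "bounded (?h ` (SG \<times> SG))"
    by (intro compact_imp_bounded compact_continuous_image h compact_Times compact_SG)
  then obtain M where M: "\<And>z. z \<in> SG \<times> SG \<Longrightarrow> norm (?h z) \<le> M"
    unfolding bounded_iff by blast
  have "SG \<times> SG \<in> sets borel"
    by (intro borel_closed closed_Times) (simp_all add: compact_imp_closed compact_SG)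
  then have "(\<lambda>z. indicator (SG \<times> SG) z *\<^sub>R ?h z) \<in> borel_measurable borel"
    using h by (rule borel_measurable_continuous_on_indicator)
  moreover have "sets (\<mu> \<Otimes>\<^sub>M \<mu>) = sets borel"
    unfolding borel_prod[symmetric] by (intro sets_pair_measure_cong sets_eq)
  ultimately have meas: "(\<lambda>z. indicator (SG \<times> SG) z *\<^sub>R ?h z) \<in> borel_measurable (\<mu> \<Otimes>\<^sub>M \<mu>)"
    using measurable_cong_sets by blast
  have "integrable (\<mu> \<Otimes>\<^sub>M \<mu>) (\<lambda>z. indicator (SG \<times> SG) z *\<^sub>R ?h z)"
  proof (rule P.integrable_const_bound[of _ "max M 0", OF AE_I2 meas])
    fix z show "norm (indicator (SG \<times> SG) z *\<^sub>R ?h z) \<le> max M 0"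
      using M[of z] by (cases "z \<in> SG \<times> SG") (auto simp: le_max_iff_disj)
  qed
  then have "integrable (\<mu> \<Otimes>\<^sub>M \<mu>) (\<lambda>(x,y). indicator SG x * (indicator SG y * (G x y * f y * g x)))"
    by (simp add: indicator_times split_def mult.assoc)
  from P.Fubini_integral[OF this]
  have "(LINT y|\<mu>. LINT x|\<mu>. indicator SG x * (indicator SG y * (G x y * f y * g x))) =
    (LINT x|\<mu>. LINT y|\<mu>. indicator SG x * (indicator SG y * (G x y * f y * g x)))" .
  moreover have "(LINT y|\<mu>. indicator SG x * (indicator SG y * (G x y * f y * g x))) =
      indicator SG x * ((LINT y:SG|\<mu>. G x y * f y) * g x)" for x
    unfolding set_lebesgue_integral_def
    by (simp add: mult.assoc flip: integral_mult_right_zero integral_mult_left_zero)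
  moreover have "(LINT x|\<mu>. indicator SG x * (indicator SG y * (G x y * f y * g x))) =
      indicator SG y * (f y * (LINT x:SG|\<mu>. G x y * g x))" for y
    unfolding set_lebesgue_integral_def
    by (simp add: mult_ac flip: integral_mult_right_zero)
  ultimately have "(LINT y|\<mu>. indicator SG y * (f y * (LINT x:SG|\<mu>. G x y * g x))) =
      (LINT x|\<mu>. indicator SG x * ((LINT y:SG|\<mu>. G x y * f y) * g x))"
    by (simp only:)
  then show ?thesis
    unfolding set_lebesgue_integral_def[of \<mu> SG "\<lambda>x. (LINT y:SG|\<mu>. G x y * f y) * g x"]
      set_lebesgue_integral_def[of \<mu> SG "\<lambda>y. f y * (LINT x:SG|\<mu>. G x y * g x)"]
    by simp
qed

end

section \<open>Jets and the Laplacian\<close>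

text \<open>A relation rather than a triple of values, so that existence of both limits is part of
  it.\<close>

definition jet :: "(real^2 \<Rightarrow> real) \<Rightarrow> real \<Rightarrow> real \<Rightarrow> real \<Rightarrow> bool" where
  "jet u a b c \<longleftrightarrow> u (q 0) = a \<and> has_normal_deriv u 0 b \<and> has_tangential_deriv u 0 c"

lemma jet_iff:
  "jet u a b c \<longleftrightarrow> u (q 0) = a \<and>
     (\<lambda>m. (5/3) ^ m * (2 * u (q 0) - u ((F 0 ^^ m) (q 1)) - u ((F 0 ^^ m) (q 2)))) \<longlonglongrightarrow> b \<and>
     (\<lambda>m. 5 ^ m * (u ((F 0 ^^ m) (q 1)) - u ((F 0 ^^ m) (q 2)))) \<longlonglongrightarrow> c"
  by (simp add: jet_def has_normal_deriv_def has_tangential_deriv_def numeral_2_eq_2)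

lemma Fpow0_q_SG: "(F 0 ^^ m) (q 0) \<in> SG" "(F 0 ^^ m) (q 1) \<in> SG" "(F 0 ^^ m) (q 2) \<in> SG"
  by (intro Fpow_SG q_SG; simp)+

lemma jet_cong:
  assumes "jet u a b c" "\<And>x. x \<in> SG \<Longrightarrow> u x = v x"
  shows "jet v a b c"
proof -
  have "u (q 0) = v (q 0)" using assms(2)[OF Fpow0_q_SG(1)[of 0]] by simp
  then show ?thesis
    using assms(1) unfolding jet_iff
    by (auto simp add: assms(2)[OF Fpow0_q_SG(2)] assms(2)[OF Fpow0_q_SG(3)] simp del: One_nat_def)
qed

lemma jet_add:
  assumes "jet u a b c" "jet u' a' b' c'"
  shows "jet (\<lambda>x. u x + u' x) (a + a') (b + b') (c + c')"
  unfolding jet_def has_normal_deriv_def has_tangential_deriv_def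
proof (intro conjI)
  show "(\<lambda>m. (5/3) ^ m * (2 * (u (q 0) + u' (q 0)) - (u ((F 0 ^^ m) (q (0 + 1))) + u' ((F 0 ^^ m) (q (0 + 1))))
      - (u ((F 0 ^^ m) (q (0 + 2))) + u' ((F 0 ^^ m) (q (0 + 2)))))) \<longlonglongrightarrow> b + b'"
  proof -
    have "(\<lambda>m. (5/3) ^ m * (2 * u (q 0) - u ((F 0 ^^ m) (q (0 + 1))) - u ((F 0 ^^ m) (q (0 + 2)))) +
        (5/3) ^ m * (2 * u' (q 0) - u' ((F 0 ^^ m) (q (0 + 1))) - u' ((F 0 ^^ m) (q (0 + 2))))) \<longlonglongrightarrow> b + b'"
      using assms unfolding jet_def has_normal_deriv_def by (intro tendsto_add) auto
    then show ?thesis by (simp add: algebra_simps)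
  qed
  show "(\<lambda>m. 5 ^ m * (u ((F 0 ^^ m) (q (0 + 1))) + u' ((F 0 ^^ m) (q (0 + 1)))
      - (u ((F 0 ^^ m) (q (0 + 2))) + u' ((F 0 ^^ m) (q (0 + 2)))))) \<longlonglongrightarrow> c + c'"
  proof -
    have "(\<lambda>m. 5 ^ m * (u ((F 0 ^^ m) (q (0 + 1))) - u ((F 0 ^^ m) (q (0 + 2)))) +
        5 ^ m * (u' ((F 0 ^^ m) (q (0 + 1))) - u' ((F 0 ^^ m) (q (0 + 2))))) \<longlonglongrightarrow> c + c'"
      using assms unfolding jet_def has_tangential_deriv_def by (intro tendsto_add) auto
    then show ?thesis by (simp add: algebra_simps)
  qed
qed (use assms in \<open>simp add: jet_def\<close>)

lemma jet_scale:
  assumes "jet u a b c"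
  shows "jet (\<lambda>x. r * u x) (r * a) (r * b) (r * c)"
  unfolding jet_def has_normal_deriv_def has_tangential_deriv_def
proof (intro conjI)
  have "(\<lambda>m. r * ((5/3) ^ m * (2 * u (q 0) - u ((F 0 ^^ m) (q (0 + 1)))
      - u ((F 0 ^^ m) (q (0 + 2)))))) \<longlonglongrightarrow> r * b"
    using assms unfolding jet_def has_normal_deriv_def by (intro tendsto_mult_left) auto
  then show "(\<lambda>m. (5/3) ^ m * (2 * (r * u (q 0)) - r * u ((F 0 ^^ m) (q (0 + 1)))
      - r * u ((F 0 ^^ m) (q (0 + 2))))) \<longlonglongrightarrow> r * b"
    by (simp add: algebra_simps)
  have "(\<lambda>m. r * (5 ^ m * (u ((F 0 ^^ m) (q (0 + 1))) - u ((F 0 ^^ m) (q (0 + 2)))))) \<longlonglongrightarrow> r * c"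
    using assms unfolding jet_def has_tangential_deriv_def by (intro tendsto_mult_left) auto
  then show "(\<lambda>m. 5 ^ m * (r * u ((F 0 ^^ m) (q (0 + 1))) - r * u ((F 0 ^^ m) (q (0 + 2))))) \<longlonglongrightarrow> r * c"
    by (simp add: algebra_simps)
qed (use assms in \<open>simp add: jet_def\<close>)

lemma jet_diff:
  assumes "jet u a b c" "jet u' a' b' c'"
  shows "jet (\<lambda>x. u x - u' x) (a - a') (b - b') (c - c')"
  using jet_add[OF assms(1) jet_scale[OF assms(2), of "-1"]] by simp

lemma jet_unique:
  assumes "jet u a b c" "jet u a' b' c'"
  shows "a = a' \<and> b = b' \<and> c = c'"
  using assms unfolding jet_def has_normal_deriv_def has_tangential_deriv_def
  by (auto dest: LIMSEQ_unique)

text \<open>The reflection commutes with \<open>F 0\<close> and exchanges \<open>q 1\<close> and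
  \<open>q 2\<close>: the normal difference is symmetric in these, the tangential one
  antisymmetric.\<close>

lemma jet_flip:
  assumes "jet u a b c"
  shows "jet (\<lambda>x. u (flip x)) a b (- c)"
proof -
  have pow: "flip ((F 0 ^^ m) x) = (F 0 ^^ m) (flip x)" for m x
    by (induction m) (simp_all add: flip_F flipi_def)
  have fq: "flip (q 0) = q 0" "flip (q 1) = q 2" "flip (q 2) = q 1"
    using flip_q[of 0] flip_q[of 1] flip_q[of 2] by (simp_all add: flipi_def)
  have "(\<lambda>m. - (5 ^ m * (u ((F 0 ^^ m) (q 1)) - u ((F 0 ^^ m) (q 2))))) \<longlonglongrightarrow> - c"
    using assms unfolding jet_iff by (intro tendsto_minus) auto
  then show ?thesis
    using assms unfolding jet_iff by (auto simp add: pow fq algebra_simps simp del: One_nat_def)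
qed

text \<open>A cubic polynomial in \<open>h\<close> vanishing on \<^term>\<open>V 0\<close> is not identically zero, since otherwise
  \<open>h\<close> would take finitely many values and be constant along the sequences defining the
  normal derivative.\<close>

lemma dom_energy_bump:
  assumes h: "h \<in> dom_energy" and d: "has_normal_deriv h 0 d" "d \<noteq> 0"
  obtains \<phi> z where "\<phi> \<in> dom_energy" "\<And>x. x \<in> V 0 \<Longrightarrow> \<phi> x = 0" "\<And>x. \<phi> x \<ge> 0"
    "z \<in> SG" "\<phi> z > 0"
proof -
  define g where "g x = (h x + - h (q 0)) * ((h x + - h (q 1)) * (h x + - h (q 2)))" for x
  have g: "g \<in> dom_energy"
    unfolding g_def[abs_def] by (intro dom_energy_mult dom_energy_add dom_energy_const h)
  have "\<exists>z\<in>SG. g z \<noteq> 0"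
  proof (rule ccontr)
    assume "\<not> ?thesis"
    then have vals: "h x \<in> {h (q 0), h (q 1), h (q 2)}" if "x \<in> SG" for x
      using that by (auto simp: g_def)
    have ev: "\<forall>\<^sub>F m in sequentially. h ((F 0 ^^ m) (q j)) = h (q 0)" if "j \<in> {0,1,2}" for j
    proof -
      have SG: "(F 0 ^^ m) (q j) \<in> SG" for m
        using that by (intro Fpow_SG q_SG) auto
      have "(\<lambda>m. h ((F 0 ^^ m) (q j))) \<longlonglongrightarrow> h (q 0)"
        by (rule continuous_on_tendsto_compose[OF dom_energy_cont[OF h] Fpow_tendsto])
           (use q_SG[of 0] SG in auto)
      \<comment> \<open>Removing the other two possible values leaves an open set containing
        \<open>h (q 0)\<close>, even if some of the three values coincide.\<close>
      moreover have "open (- ({h (q 1), h (q 2)} - {h (q 0)}))"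
        by (intro open_Compl finite_imp_closed) simp
      ultimately have "\<forall>\<^sub>F m in sequentially. h ((F 0 ^^ m) (q j)) \<in> - ({h (q 1), h (q 2)} - {h (q 0)})"
        by (rule topological_tendstoD) simp
      then show ?thesis
        by (rule eventually_mono) (use vals[OF SG] in blast)
    qed
    have "\<forall>\<^sub>F m in sequentially. h ((F 0 ^^ m) (q 1)) = h (q 0)"
      "\<forall>\<^sub>F m in sequentially. h ((F 0 ^^ m) (q 2)) = h (q 0)"
      by (intro ev; simp)+
    then have "\<forall>\<^sub>F m in sequentially. (5/3) ^ m * (2 * h (q 0) - h ((F 0 ^^ m) (q (0 + 1)))
        - h ((F 0 ^^ m) (q (0 + 2)))) = 0"
      by eventually_elim (simp add: numeral_2_eq_2)
    then have "has_normal_deriv h 0 0"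
      unfolding has_normal_deriv_def by (rule tendsto_eventually)
    then show False using d LIMSEQ_unique unfolding has_normal_deriv_def by blast
  qed
  then obtain z where z: "z \<in> SG" "g z \<noteq> 0" by blast
  show thesis
  proof (rule that)
    show "(\<lambda>x. g x * g x) \<in> dom_energy" by (intro dom_energy_mult g)
    show "g x * g x = 0" if "x \<in> V 0" for x using that by (auto simp: V_0 g_def)
    show "g z * g z > 0" using z(2) by (metis not_real_square_gt_zero)
  qed (use z in auto)
qed

lemma dom_energy_cong:
  assumes "u \<in> dom_energy" "\<And>x. x \<in> SG \<Longrightarrow> u x = v x"
  shows "v \<in> dom_energy"
proof -
  have "continuous_on SG v" using dom_energy_cont[OF assms(1)] assms(2) by (rule continuous_on_eq)
  moreover have "graph_energy m v v = graph_energy m u u" for m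
    using assms(2) by (intro graph_energy_cong) auto
  ultimately show ?thesis using assms(1) by (simp add: dom_energy_iff)
qed

section \<open>Linearity and symmetry of the Laplacian, and density of test functions\<close>

context sg_measure
begin

lemma LINT_add:
  fixes f g :: "real^2 \<Rightarrow> real"
  assumes "continuous_on SG f" "continuous_on SG g"
  shows "(LINT x:SG|\<mu>. f x + g x) = (LINT x:SG|\<mu>. f x) + (LINT x:SG|\<mu>. g x)"
  by (rule set_integral_add(2)) (intro cont_set_integrable assms)+

lemma LINT_scale:
  fixes f :: "real^2 \<Rightarrow> real"
  shows "(LINT x:SG|\<mu>. c * f x) = c * (LINT x:SG|\<mu>. f x)"
  by (rule set_integral_mult_right)

lemma has_laplacianD:
  assumes "has_laplacian \<mu> u f"
  shows "u \<in> dom_energy" "continuous_on SG u" "continuous_on SG f"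
    "\<And>v. v \<in> dom_energy \<Longrightarrow> (\<And>x. x \<in> V 0 \<Longrightarrow> v x = 0) \<Longrightarrow>
      has_energy u v (- (LINT x:SG|\<mu>. f x * v x))"
  using assms dom_energy_cont by (auto simp: has_laplacian_def)

lemma has_laplacian_cong:
  assumes "has_laplacian \<mu> u f" "\<And>x. x \<in> SG \<Longrightarrow> u x = u' x" "\<And>x. x \<in> SG \<Longrightarrow> f x = f' x"
  shows "has_laplacian \<mu> u' f'"
  unfolding has_laplacian_def
proof (intro conjI ballI impI)
  show "u' \<in> dom_energy" by (rule dom_energy_cong[OF has_laplacianD(1)[OF assms(1)] assms(2)])
  show "continuous_on SG f'" by (rule continuous_on_eq[OF has_laplacianD(3)[OF assms(1)] assms(3)])
  fix v assume v: "v \<in> dom_energy" "\<forall>x\<in>V 0. v x = 0"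
  have "(LINT x:SG|\<mu>. f' x * v x) = (LINT x:SG|\<mu>. f x * v x)"
    using assms(3) by (intro LINT_cong) simp
  moreover have "graph_energy m u' v = graph_energy m u v" for m
    using assms(2) by (intro graph_energy_cong) auto
  ultimately show "has_energy u' v (- (LINT x:SG|\<mu>. f' x * v x))"
    using has_laplacianD(4)[OF assms(1) v(1)] v(2) by (simp add: has_energy_def)
qed

lemma has_laplacian_add:
  assumes u: "has_laplacian \<mu> u f" and u': "has_laplacian \<mu> u' f'"
  shows "has_laplacian \<mu> (\<lambda>x. u x + u' x) (\<lambda>x. f x + f' x)"
  unfolding has_laplacian_def
proof (intro conjI ballI impI)
  show "(\<lambda>x. u x + u' x) \<in> dom_energy"
    by (intro dom_energy_add has_laplacianD(1)[OF u] has_laplacianD(1)[OF u'])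
  show "continuous_on SG (\<lambda>x. f x + f' x)"
    by (intro continuous_intros has_laplacianD(3)[OF u] has_laplacianD(3)[OF u'])
  fix v assume v: "v \<in> dom_energy" "\<forall>x\<in>V 0. v x = 0"
  have "(LINT x:SG|\<mu>. f x * v x + f' x * v x) = (LINT x:SG|\<mu>. f x * v x) + (LINT x:SG|\<mu>. f' x * v x)"
    by (intro LINT_add continuous_intros dom_energy_cont[OF v(1)] has_laplacianD(3)[OF u] has_laplacianD(3)[OF u'])
  then show "has_energy (\<lambda>x. u x + u' x) v (- (LINT x:SG|\<mu>. (f x + f' x) * v x))"
    using tendsto_add[OF has_laplacianD(4)[OF u v(1), unfolded has_energy_def]
        has_laplacianD(4)[OF u' v(1), unfolded has_energy_def]] v(2)
    by (simp add: has_energy_def graph_energy_add_left distrib_right)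
qed

lemma has_laplacian_scale:
  assumes u: "has_laplacian \<mu> u f"
  shows "has_laplacian \<mu> (\<lambda>x. c * u x) (\<lambda>x. c * f x)"
  unfolding has_laplacian_def
proof (intro conjI ballI impI)
  show "(\<lambda>x. c * u x) \<in> dom_energy"
    by (intro dom_energy_scale has_laplacianD(1)[OF u])
  show "continuous_on SG (\<lambda>x. c * f x)"
    by (intro continuous_intros has_laplacianD(3)[OF u])
  fix v assume v: "v \<in> dom_energy" "\<forall>x\<in>V 0. v x = 0"
  then show "has_energy (\<lambda>x. c * u x) v (- (LINT x:SG|\<mu>. c * f x * v x))"
    using tendsto_mult_left[OF has_laplacianD(4)[OF u v(1), unfolded has_energy_def], of c]
    by (simp add: has_energy_def graph_energy_scale_left LINT_scale mult.assoc)
qed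

lemma has_laplacian_0: "has_laplacian \<mu> (\<lambda>x. 0) (\<lambda>x. 0)"
  unfolding has_laplacian_def has_energy_def
  using dom_energy_const[of 0] by (simp add: graph_energy_edges set_lebesgue_integral_def)

lemma has_laplacian_diff:
  assumes "has_laplacian \<mu> u f" "has_laplacian \<mu> u' f'"
  shows "has_laplacian \<mu> (\<lambda>x. u x - u' x) (\<lambda>x. f x - f' x)"
  using has_laplacian_add[OF assms(1) has_laplacian_scale[OF assms(2), of "-1"]] by simp

lemma has_laplacian_sum:
  assumes "\<And>i. i \<in> I \<Longrightarrow> has_laplacian \<mu> (u i) (f i)"
  shows "has_laplacian \<mu> (\<lambda>x. \<Sum>i\<in>I. c i * u i x) (\<lambda>x. \<Sum>i\<in>I. c i * f i x)"
  using assms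
proof (induction I rule: infinite_finite_induct)
  case (insert i I)
  then show ?case
    using has_laplacian_add[OF has_laplacian_scale[of "u i" "f i" "c i"] insert.IH] by simp
qed (simp_all add: has_laplacian_0)

text \<open>The reflection is moved onto the test function, which stays in the domain and still
  vanishes on \<open>V 0\<close>; energy and integral are both invariant.\<close>

lemma has_laplacian_flip:
  assumes u: "has_laplacian \<mu> u f"
  shows "has_laplacian \<mu> (\<lambda>x. u (flip x)) (\<lambda>x. f (flip x))"
  unfolding has_laplacian_def
proof (intro conjI ballI impI)
  show "(\<lambda>x. u (flip x)) \<in> dom_energy"
    using dom_energy_flip[OF has_laplacianD(1)[OF u]] by (simp add: comp_def)
  show f: "continuous_on SG (\<lambda>x. f (flip x))"
    using continuous_on_SG_flip[OF has_laplacianD(3)[OF u]] by (simp add: comp_def)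
  fix v assume v: "v \<in> dom_energy" "\<forall>x\<in>V 0. v x = 0"
  have "graph_energy m (\<lambda>x. u (flip x)) v = graph_energy m u (v \<circ> flip)" for m
    using graph_energy_flip[of m u "v \<circ> flip"] by (simp add: comp_def)
  moreover have "has_energy u (v \<circ> flip) (- (LINT x:SG|\<mu>. f x * (v \<circ> flip) x))"
    using v flip_V0 by (intro has_laplacianD(4)[OF u] dom_energy_flip) auto
  moreover have "(LINT x:SG|\<mu>. f x * (v \<circ> flip) x) = (LINT x:SG|\<mu>. f (flip x) * v x)"
    using LINT_flip[of "\<lambda>x. f (flip x) * v x"] f dom_energy_cont[OF v(1)]
    by (simp add: continuous_on_mult)
  ultimately show "has_energy (\<lambda>x. u (flip x)) v (- (LINT x:SG|\<mu>. f (flip x) * v x))"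
    by (simp add: has_energy_def)
qed

text \<open>If \<open>f z > 0\<close>, then \<open>f\<close> is positive on a small cell; a
  nonnegative bump transplanted there has integral 0 against \<open>f\<close>, so their product
  vanishes identically, contradicting the point where the bump is positive. The function
  \<open>h\<close> supplies the bump.\<close>

lemma dom_energy_dense_le:
  assumes h: "h \<in> dom_energy" "has_normal_deriv h 0 d" "d \<noteq> 0"
    and f: "continuous_on SG f"
    and orth: "\<And>v. v \<in> dom_energy \<Longrightarrow> (\<And>x. x \<in> V 0 \<Longrightarrow> v x = 0) \<Longrightarrow> (LINT x:SG|\<mu>. f x * v x) = 0"
    and z: "z \<in> SG"
  shows "f z \<le> 0"
proof (rule ccontr)
  assume "\<not> f z \<le> 0"
  then have pos: "f z > 0" by simp
  obtain \<phi> y where \<phi>: "\<phi> \<in> dom_energy" "\<And>x. x \<in> V 0 \<Longrightarrow> \<phi> x = 0" "\<And>x. \<phi> x \<ge> 0"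
    and y: "y \<in> SG" "\<phi> y > 0"
    using dom_energy_bump[OF h] by blast
  obtain \<delta> where \<delta>: "\<delta> > 0" "\<And>x. x \<in> SG \<Longrightarrow> dist x z < \<delta> \<Longrightarrow> dist (f x) (f z) < f z"
    using f z pos unfolding continuous_on_iff by metis
  obtain m w where w: "w \<in> words m" "\<forall>x\<in>Fw w ` SG. dist x z < \<delta>"
    using cell_neighbourhood[OF z \<delta>(1)] by (elim exE bexE conjE)
  have fpos: "f x > 0" if "x \<in> Fw w ` SG" for x
  proof -
    have "x \<in> SG" using Fw_SG_subset[OF w(1)] that by blast
    then have "\<bar>f x - f z\<bar> < f z" using \<delta>(2) bspec[OF w(2) that] by (simp add: dist_real_def)
    then show ?thesis by linarith
  qed
  obtain \<psi> where \<psi>: "\<psi> \<in> dom_energy" "\<forall>x\<in>V 0. \<psi> x = 0" "\<forall>x\<in>SG. \<psi> (Fw w x) = \<phi> x"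
    "\<forall>x. x \<notin> Fw w ` SG \<longrightarrow> \<psi> x = 0"
    using dom_energy_glue_word[OF w(1) \<phi>(1,2)] by blast
  have "f (Fw w y) * \<psi> (Fw w y) = 0"
  proof (rule LINT_0_imp[of "\<lambda>x. f x * \<psi> x"])
    show "continuous_on SG (\<lambda>x. f x * \<psi> x)"
      by (intro continuous_intros f dom_energy_cont \<psi>(1))
    show "f x * \<psi> x \<ge> 0" if "x \<in> SG" for x
    proof (cases "x \<in> Fw w ` SG")
      case True
      then have "\<psi> x \<ge> 0" using \<psi>(3) \<phi>(3) by auto
      then show ?thesis using fpos[OF True] by simp
    next
      case False
      then show ?thesis using \<psi>(4) by simp
    qed
    show "(LINT x:SG|\<mu>. f x * \<psi> x) = 0" using \<psi>(2) by (intro orth \<psi>(1)) blast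
    show "Fw w y \<in> SG" using Fw_SG[OF w(1) y(1)] .
  qed
  moreover have "f (Fw w y) > 0" using fpos y(1) by blast
  moreover have "\<psi> (Fw w y) > 0" using \<psi>(3) y by simp
  ultimately show False by simp
qed

lemma dom_energy_dense:
  assumes h: "h \<in> dom_energy" "has_normal_deriv h 0 d" "d \<noteq> 0"
    and f: "continuous_on SG f"
    and orth: "\<And>v. v \<in> dom_energy \<Longrightarrow> (\<And>x. x \<in> V 0 \<Longrightarrow> v x = 0) \<Longrightarrow> (LINT x:SG|\<mu>. f x * v x) = 0"
    and z: "z \<in> SG"
  shows "f z = 0"
proof -
  have "- f z \<le> 0"
  proof (rule dom_energy_dense_le[OF h _ _ z])
    show "continuous_on SG (\<lambda>x. - f x)" by (intro continuous_intros f)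
    show "(LINT x:SG|\<mu>. - f x * v x) = 0" if "v \<in> dom_energy" "\<And>x. x \<in> V 0 \<Longrightarrow> v x = 0" for v
      using orth[OF that] LINT_scale[of "-1" "\<lambda>x. f x * v x"] by simp
  qed
  then show ?thesis using dom_energy_dense_le[OF h f orth z] by simp
qed

lemma is_monomial_0D:
  assumes "is_monomial \<mu> 0 k Q"
  shows "has_laplacian \<mu> Q (\<lambda>x. 0)" "jet Q (of_bool (k = 1)) (of_bool (k = 2)) (of_bool (k = 3))"
proof -
  obtain D where D: "D 0 = Q" "has_laplacian \<mu> (D 0) (D (Suc 0))" "\<forall>x\<in>SG. D (Suc 0) x = 0"
    "jet (D 0) (of_bool (k = 1)) (of_bool (k = 2)) (of_bool (k = 3))"
    using assms by (auto simp: is_monomial_def jet_def)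
  show "has_laplacian \<mu> Q (\<lambda>x. 0)"
    using has_laplacian_cong[OF D(2)] D(1,3) by simp
  show "jet Q (of_bool (k = 1)) (of_bool (k = 2)) (of_bool (k = 3))" using D(1,4) by simp
qed

text \<open>Only the top of the tower \<open>D\<close> carries a nonzero jet, so the bottom has jet
  0; shifting the tower by one exhibits the Laplacian as a monomial of the next lower
  degree.\<close>

lemma is_monomial_SucD:
  assumes "is_monomial \<mu> (Suc j) k Q"
  shows "jet Q 0 0 0" "\<exists>R. has_laplacian \<mu> Q R \<and> is_monomial \<mu> j k R"
proof -
  obtain D where D: "D 0 = Q" "\<forall>n\<le>Suc j. has_laplacian \<mu> (D n) (D (Suc n))"
    "\<forall>x\<in>SG. D (Suc (Suc j)) x = 0"
    "\<forall>n\<le>Suc j. D n (q 0) = of_bool (n = Suc j \<and> k = 1) \<and>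
             has_normal_deriv (D n) 0 (of_bool (n = Suc j \<and> k = 2)) \<and>
             has_tangential_deriv (D n) 0 (of_bool (n = Suc j \<and> k = 3))"
    using assms unfolding is_monomial_def by blast
  show "jet Q 0 0 0" using D(1) D(4)[rule_format, of 0] by (simp add: jet_def)
  have "is_monomial \<mu> j k (D (Suc 0))"
    unfolding is_monomial_def
    using D(2,3) D(4)[rule_format, of "Suc _"] by (intro exI[of _ "\<lambda>n. D (Suc n)"]) simp
  then show "\<exists>R. has_laplacian \<mu> Q R \<and> is_monomial \<mu> j k R"
    using D(1,2) by blast
qed

text \<open>The sign \<open>r\<close> undoes the effect of the reflection on the one nonzero jet
  component, normal for \<open>k = 2\<close> and tangential for \<open>k = 3\<close>.\<close>

lemma is_monomial_flip:
  assumes "is_monomial \<mu> j k Q" "k \<noteq> 1" and r: "r = (if k = 2 then 1 else -1)"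
  shows "is_monomial \<mu> j k (\<lambda>x. r * Q (flip x))"
proof -
  obtain D where D: "D 0 = Q" "\<forall>n\<le>j. has_laplacian \<mu> (D n) (D (Suc n))"
    "\<forall>x\<in>SG. D (Suc j) x = 0"
    "\<forall>n\<le>j. jet (D n) (of_bool (n = j \<and> k = 1)) (of_bool (n = j \<and> k = 2)) (of_bool (n = j \<and> k = 3))"
    using assms unfolding is_monomial_def jet_def by blast
  let ?D = "\<lambda>n x. r * D n (flip x)"
  have "jet (?D n) (of_bool (n = j \<and> k = 1)) (of_bool (n = j \<and> k = 2)) (of_bool (n = j \<and> k = 3))"
    if "n \<le> j" for n
    using jet_scale[OF jet_flip[OF D(4)[rule_format, OF that]], of r] assms(2) r
    by (auto split: if_splits)
  moreover have "has_laplacian \<mu> (?D n) (?D (Suc n))" if "n \<le> j" for n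
    by (intro has_laplacian_scale has_laplacian_flip D(2)[rule_format] that)
  ultimately show ?thesis
    unfolding is_monomial_def using D(1,3) flip_SG
    by (intro exI[of _ ?D]) (simp add: jet_def)
qed

end

section \<open>Monomials and Green's function\<close>

locale green_monomials = sg_measure +
  fixes G :: "real^2 \<Rightarrow> real^2 \<Rightarrow> real" and P :: "nat \<Rightarrow> nat \<Rightarrow> real^2 \<Rightarrow> real"
  assumes green: "is_green \<mu> G"
    and monomial: "l \<in> {1,2,3} \<Longrightarrow> is_monomial \<mu> j l (P j l)"
begin

text \<open>\<open>P 0 2\<close> has normal derivative 1 and so provides the bumps; the difference
  of two Laplacians is orthogonal to all test functions.\<close>

lemma has_laplacian_unique:
  assumes u: "has_laplacian \<mu> u f" "has_laplacian \<mu> u g" and x: "x \<in> SG"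
  shows "f x = g x"
proof -
  have P02: "P 0 2 \<in> dom_energy" "has_normal_deriv (P 0 2) 0 1"
    using is_monomial_0D[OF monomial[of 2 0]] has_laplacianD(1) by (auto simp: jet_def)
  have "f x - g x = 0"
  proof (rule dom_energy_dense[OF P02 _ _ _ x])
    show "continuous_on SG (\<lambda>x. f x - g x)"
      by (intro continuous_intros has_laplacianD(3)[OF u(1)] has_laplacianD(3)[OF u(2)])
    fix v assume v: "v \<in> dom_energy" "\<And>x. x \<in> V 0 \<Longrightarrow> v x = 0"
    have "(LINT x:SG|\<mu>. f x * v x) = (LINT x:SG|\<mu>. g x * v x)"
      using LIMSEQ_unique[OF has_laplacianD(4)[OF u(1) v, unfolded has_energy_def]
          has_laplacianD(4)[OF u(2) v, unfolded has_energy_def]] by simp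
    moreover have "(LINT x:SG|\<mu>. f x * v x + - (g x * v x)) =
        (LINT x:SG|\<mu>. f x * v x) + (LINT x:SG|\<mu>. - (g x * v x))"
      by (intro LINT_add continuous_intros dom_energy_cont[OF v(1)] has_laplacianD(3)[OF u(1)]
          has_laplacianD(3)[OF u(2)])
    ultimately show "(LINT x:SG|\<mu>. (f x - g x) * v x) = 0"
      using LINT_scale[of "-1" "\<lambda>x. g x * v x"] by (simp add: left_diff_distrib)
  qed simp
  then show ?thesis by simp
qed

text \<open>Replaces the chosen Laplacian in \<open>innerS\<close> by any known one.\<close>

lemma laplacian_eq:
  assumes "has_laplacian \<mu> u f" "x \<in> SG"
  shows "laplacian \<mu> u x = f x"
proof -
  have "has_laplacian \<mu> u (laplacian \<mu> u)"
    unfolding laplacian_def using assms(1) by (rule someI[of "has_laplacian \<mu> u"])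
  then show ?thesis using assms by (rule has_laplacian_unique)
qed

lemma green_unique:
  assumes "has_laplacian \<mu> u f" "\<And>x. x \<in> V 0 \<Longrightarrow> u x = 0" "x \<in> SG"
  shows "u x = - (LINT y:SG|\<mu>. G x y * f y)"
proof -
  have f: "continuous_on SG (\<lambda>x. - f x)" by (intro continuous_intros has_laplacianD(3)[OF assms(1)])
  have "has_laplacian \<mu> u (\<lambda>x. - (- f x))" using assms(1) by simp
  then have "\<forall>x\<in>SG. u x = (LINT y:SG|\<mu>. G x y * - f y)"
    using green f assms(2) unfolding is_green_def by blast
  then have "u x = (LINT y:SG|\<mu>. G x y * - f y)" using assms(3) ..
  then show ?thesis using LINT_scale[of "-1" "\<lambda>y. G x y * f y"] by simp
qed

lemma harmonic_boundary_0:
  assumes "has_laplacian \<mu> u (\<lambda>x. 0)" "\<And>x. x \<in> V 0 \<Longrightarrow> u x = 0" "x \<in> SG"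
  shows "u x = 0"
  using green_unique[OF assms] by (simp add: set_lebesgue_integral_def)

text \<open>By uniqueness for the Dirichlet problem, harmonic functions form a space of dimension at most
  three, in which \<^term>\<open>P 0 1\<close>, \<^term>\<open>P 0 2\<close>, \<^term>\<open>P 0 3\<close> are independent because their jets at
  \<^term>\<open>q 0\<close> are.\<close>

lemma harmonic_jet_0:
  assumes h: "has_laplacian \<mu> h (\<lambda>x. 0)" "jet h 0 0 0" and x: "x \<in> SG"
  shows "h x = 0"
proof -
  define u where "u c x = c$1 * P 0 1 x + c$2 * P 0 2 x + c$3 * P 0 3 x" for c :: "real^3" and x
  have P0: "has_laplacian \<mu> (P 0 l) (\<lambda>x. 0)" if "l \<in> {1,2,3}" for l
    using is_monomial_0D(1)[OF monomial[OF that]] .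
  have J0: "jet (P 0 1) 1 0 0" "jet (P 0 2) 0 1 0" "jet (P 0 3) 0 0 1"
    using is_monomial_0D(2)[OF monomial[of 1 0]] is_monomial_0D(2)[OF monomial[of 2 0]]
      is_monomial_0D(2)[OF monomial[of 3 0]] by simp_all
  have lap: "has_laplacian \<mu> (u c) (\<lambda>x. 0)" for c
  proof -
    have "has_laplacian \<mu> (u c) (\<lambda>x. c$1 * 0 + c$2 * 0 + c$3 * 0)"
      unfolding u_def[abs_def] by (intro has_laplacian_add has_laplacian_scale P0) auto
    then show ?thesis by simp
  qed
  have jet: "jet (u c) (c$1) (c$2) (c$3)" for c
    using jet_add[OF jet_add[OF jet_scale[OF J0(1), of "c$1"] jet_scale[OF J0(2), of "c$2"]]
        jet_scale[OF J0(3), of "c$3"]]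
    by (simp add: u_def[abs_def])
  \<comment> \<open>Coefficients to boundary values. If these vanish, so does \<open>u c\<close>,
    and then its jet, which is \<open>c\<close>. Injectivity in dimension 3 gives surjectivity, so
    every harmonic function is some \<open>u c\<close> on \<open>SG\<close>.\<close>
  define L :: "real^3 \<Rightarrow> real^3" where "L c = vector [u c (q 0), u c (q 1), u c (q 2)]" for c
  have "linear L"
    by (rule linearI) (simp_all add: L_def u_def vec_eq_iff forall_3 algebra_simps)
  moreover have "inj L"
    unfolding linear_injective_0[OF \<open>linear L\<close>]
  proof (intro allI impI)
    fix c assume "L c = 0"
    then have "u c (q 0) = 0" "u c (q 1) = 0" "u c (q 2) = 0"
      by (simp_all add: L_def vec_eq_iff forall_3)
    then have "u c x = 0" if "x \<in> SG" for x
      using harmonic_boundary_0[OF lap _ that, of c] by (auto simp: V_0)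
    then have "jet (\<lambda>x. 0) (c$1) (c$2) (c$3)" by (rule jet_cong[OF jet])
    moreover have "jet (\<lambda>x. 0) 0 0 0"
      by (simp add: jet_iff)
    ultimately have "c$1 = 0 \<and> c$2 = 0 \<and> c$3 = 0" by (rule jet_unique)
    then show "c = 0" by (simp add: vec_eq_iff forall_3)
  qed
  ultimately have "surj L" by (rule linear_inj_imp_surj)
  then obtain c where c: "L c = vector [h (q 0), h (q 1), h (q 2)]" by (metis surjD)
  then have V0: "h (q 0) = u c (q 0)" "h (q 1) = u c (q 1)" "h (q 2) = u c (q 2)"
    by (simp_all add: L_def vec_eq_iff forall_3)
  have hlap: "has_laplacian \<mu> (\<lambda>x. h x - u c x) (\<lambda>x. 0)"
    using has_laplacian_diff[OF h(1) lap[of c]] by simp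
  have eq: "h x = u c x" if "x \<in> SG" for x
    using harmonic_boundary_0[OF hlap _ that] V0 by (auto simp: V_0)
  have "jet (u c) 0 0 0" using jet_cong[OF h(2) eq] .
  then have "c$1 = 0 \<and> c$2 = 0 \<and> c$3 = 0" using jet_unique[OF jet] by blast
  then show ?thesis using eq[OF x] by (simp add: u_def)
qed

section \<open>Monomials and their boundary values\<close>

text \<open>By induction the Laplacians agree, so the difference is harmonic with zero jet.\<close>

lemma monomial_unique:
  assumes "is_monomial \<mu> j k Q" "is_monomial \<mu> j k R" "x \<in> SG"
  shows "Q x = R x"
  using assms
proof (induction j arbitrary: Q R x)
  case 0
  note Q = is_monomial_0D[OF 0(1)] and R = is_monomial_0D[OF 0(2)]
  have "Q x - R x = 0"
    using has_laplacian_diff[OF Q(1) R(1)] jet_diff[OF Q(2) R(2)]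
    by (intro harmonic_jet_0 0(3)) simp_all
  then show ?case by simp
next
  case (Suc j)
  obtain Q' where Q': "has_laplacian \<mu> Q Q'" "is_monomial \<mu> j k Q'"
    using is_monomial_SucD(2)[OF Suc.prems(1)] by blast
  obtain R' where R': "has_laplacian \<mu> R R'" "is_monomial \<mu> j k R'"
    using is_monomial_SucD(2)[OF Suc.prems(2)] by blast
  have "has_laplacian \<mu> (\<lambda>x. Q x - R x) (\<lambda>x. 0)"
    by (rule has_laplacian_cong[OF has_laplacian_diff[OF Q'(1) R'(1)]])
       (simp_all add: Suc.IH[OF Q'(2) R'(2)])
  moreover have "jet (\<lambda>x. Q x - R x) 0 0 0"
    using jet_diff[OF is_monomial_SucD(1)[OF Suc.prems(1)] is_monomial_SucD(1)[OF Suc.prems(2)]]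
    by simp
  ultimately have "Q x - R x = 0" using Suc.prems(3) by (rule harmonic_jet_0)
  then show ?case by simp
qed

text \<open>The definition only yields some monomial of degree \<open>j\<close> as Laplacian;
  uniqueness identifies it with the given one.\<close>

lemma has_laplacian_P_Suc:
  assumes "l \<in> {1,2,3}"
  shows "has_laplacian \<mu> (P (Suc j) l) (P j l)"
proof -
  obtain R where R: "has_laplacian \<mu> (P (Suc j) l) R" "is_monomial \<mu> j l R"
    using is_monomial_SucD(2)[OF monomial[OF assms]] by blast
  show ?thesis
    by (rule has_laplacian_cong[OF R(1) refl monomial_unique[OF R(2) monomial[OF assms]]])
qed

lemma has_laplacian_P_0:
  assumes "l \<in> {1,2,3}"
  shows "has_laplacian \<mu> (P 0 l) (\<lambda>x. 0)"
  using is_monomial_0D(1)[OF monomial[OF assms]] .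

text \<open>The reflected monomial with the right sign is a monomial with the same indices, so it
  equals the original on \<open>SG\<close>.\<close>

lemma P_boundary:
  assumes "l = 2 \<or> l = 3"
  shows "P j l (q 0) = 0" "P j l (q 2) = (if l = 2 then 1 else -1) * P j l (q 1)"
proof -
  have l: "l \<in> {1,2,3}" using assms by auto
  show "P j l (q 0) = 0"
  proof (cases j)
    case 0
    then show ?thesis using is_monomial_0D(2)[OF monomial[OF l, of 0]] assms by (auto simp: jet_def)
  next
    case (Suc i)
    then show ?thesis using is_monomial_SucD(1)[OF monomial[OF l, of "Suc i"]] by (simp add: jet_def)
  qed
  have "is_monomial \<mu> j l (\<lambda>x. (if l = 2 then 1 else -1) * P j l (flip x))"
    using assms by (intro is_monomial_flip monomial l refl) auto
  from monomial_unique[OF monomial[OF l] this q_SG[of 2]]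
  show "P j l (q 2) = (if l = 2 then 1 else -1) * P j l (q 1)"
    using flip_q[of 2] by (simp add: flipi_def del: One_nat_def)
qed

text \<open>Otherwise all three boundary values would vanish, hence the harmonic function and its
  jet. This value is the divisor in the boundary correction.\<close>

lemma P_0_boundary_neq_0:
  assumes "l = 2 \<or> l = 3"
  shows "P 0 l (q 1) \<noteq> 0"
proof
  assume 0: "P 0 l (q 1) = 0"
  have l: "l \<in> {1,2,3}" using assms by auto
  have "P 0 l x = 0" if "x \<in> SG" for x
    using harmonic_boundary_0[OF has_laplacian_P_0[OF l] _ that] P_boundary[OF assms, of 0] 0
    by (auto simp: V_0)
  then have "jet (\<lambda>x. 0) (of_bool (l = 1)) (of_bool (l = 2)) (of_bool (l = 3))"
    by (rule jet_cong[OF is_monomial_0D(2)[OF monomial[OF l]]])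
  moreover have "jet (\<lambda>x. 0) 0 0 0"
    by (simp add: jet_iff)
  ultimately have "l \<noteq> 2 \<and> l \<noteq> 3" using jet_unique by fastforce
  then show False using assms by blast
qed

text \<open>For \<open>l = 2, 3\<close> the boundary values of \<^term>\<open>P (Suc j) l\<close> are proportional to those of the
  harmonic function \<^term>\<open>P 0 l\<close> by symmetry, so subtracting a multiple of the latter solves the
  Dirichlet problem.\<close>

lemma green_P:
  assumes "l = 2 \<or> l = 3"
  shows "\<exists>d. has_laplacian \<mu> (\<lambda>x. P (Suc j) l x + d * P 0 l x) (P j l) \<and>
    (\<forall>x\<in>V 0. P (Suc j) l x + d * P 0 l x = 0)"
proof -
  have l: "l \<in> {1,2,3}" using assms by auto
  \<comment> \<open>Fitted at \<open>q 1\<close> only: the common parity carries the cancellation to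
    \<open>q 2\<close>, and both functions vanish at \<open>q 0\<close>.\<close>
  define d where "d = - P (Suc j) l (q 1) / P 0 l (q 1)"
  have "has_laplacian \<mu> (\<lambda>x. P (Suc j) l x + d * P 0 l x) (\<lambda>x. P j l x + d * 0)"
    by (intro has_laplacian_add has_laplacian_scale has_laplacian_P_Suc has_laplacian_P_0 l)
  then have lap: "has_laplacian \<mu> (\<lambda>x. P (Suc j) l x + d * P 0 l x) (P j l)" by simp
  have d: "P (Suc j) l (q 1) + d * P 0 l (q 1) = 0"
    using P_0_boundary_neq_0[OF assms] by (simp add: d_def)
  have "P (Suc j) l (q 2) + d * P 0 l (q 2) =
      (if l = 2 then 1 else -1) * (P (Suc j) l (q 1) + d * P 0 l (q 1))"
    unfolding P_boundary(2)[OF assms] by (simp add: algebra_simps)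
  then have "P (Suc j) l x + d * P 0 l x = 0" if "x \<in> V 0" for x
    using that d P_boundary(1)[OF assms] by (auto simp: V_0)
  then show ?thesis using lap by blast
qed

section \<open>The two inner products\<close>

lemma inner2_cong:
  "(\<And>x. x \<in> SG \<Longrightarrow> u x = u' x) \<Longrightarrow> (\<And>x. x \<in> SG \<Longrightarrow> v x = v' x) \<Longrightarrow> inner2 \<mu> u v = inner2 \<mu> u' v'"
  unfolding inner2_def by (intro LINT_cong) simp

lemma inner2_commute: "inner2 \<mu> u v = inner2 \<mu> v u"
  by (simp add: inner2_def mult.commute)

lemma inner2_add:
  assumes "continuous_on SG u" "continuous_on SG u'" "continuous_on SG v"
  shows "inner2 \<mu> (\<lambda>x. u x + u' x) v = inner2 \<mu> u v + inner2 \<mu> u' v"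
  unfolding inner2_def distrib_right by (intro LINT_add continuous_intros assms)

lemma inner2_scale: "inner2 \<mu> (\<lambda>x. c * u x) v = c * inner2 \<mu> u v"
  unfolding inner2_def mult.assoc by (rule LINT_scale)

lemma inner2_nonneg: "inner2 \<mu> u u \<ge> 0"
  unfolding inner2_def set_lebesgue_integral_def by (rule integral_nonneg_AE) simp

lemma inner2_0_imp:
  assumes "continuous_on SG u" "inner2 \<mu> u u = 0" "x \<in> SG"
  shows "u x = 0"
  using LINT_0_imp[of "\<lambda>x. u x * u x" x] assms by (simp add: inner2_def continuous_on_mult)

lemma innerS_eq:
  assumes "has_laplacian \<mu> u f" "has_laplacian \<mu> v g"
  shows "innerS \<mu> chi u v = inner2 \<mu> u v + chi * inner2 \<mu> f g"
  using inner2_cong[OF laplacian_eq[OF assms(1)] laplacian_eq[OF assms(2)]]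
  by (simp add: innerS_def)

lemma innerS_commute: "innerS \<mu> chi u v = innerS \<mu> chi v u"
  by (simp add: innerS_def inner2_commute)

lemma innerS_cong:
  assumes "has_laplacian \<mu> u f" "has_laplacian \<mu> v g" "\<And>x. x \<in> SG \<Longrightarrow> u x = u' x"
  shows "innerS \<mu> chi u v = innerS \<mu> chi u' v"
proof -
  have "has_laplacian \<mu> u' f" by (rule has_laplacian_cong[OF assms(1,3) refl])
  moreover have "inner2 \<mu> u v = inner2 \<mu> u' v" by (rule inner2_cong[OF assms(3) refl])
  ultimately show ?thesis using innerS_eq assms(1,2) by simp
qed

lemma innerS_add:
  assumes "has_laplacian \<mu> u f" "has_laplacian \<mu> u' f'" "has_laplacian \<mu> v g"
  shows "innerS \<mu> chi (\<lambda>x. u x + u' x) v = innerS \<mu> chi u v + innerS \<mu> chi u' v"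
  unfolding innerS_eq[OF has_laplacian_add[OF assms(1,2)] assms(3)]
    innerS_eq[OF assms(1,3)] innerS_eq[OF assms(2,3)]
  using assms by (simp add: inner2_add has_laplacianD(2,3) algebra_simps)

lemma innerS_scale:
  assumes "has_laplacian \<mu> u f" "has_laplacian \<mu> v g"
  shows "innerS \<mu> chi (\<lambda>x. c * u x) v = c * innerS \<mu> chi u v"
  unfolding innerS_eq[OF has_laplacian_scale[OF assms(1)] assms(2)] innerS_eq[OF assms]
  by (simp add: inner2_scale algebra_simps)

lemma innerS_nonneg: "chi \<ge> 0 \<Longrightarrow> innerS \<mu> chi u u \<ge> 0"
  unfolding innerS_def by (intro add_nonneg_nonneg mult_nonneg_nonneg inner2_nonneg)

lemma innerS_0_imp:
  assumes "has_laplacian \<mu> u f" "chi \<ge> 0" "innerS \<mu> chi u u = 0" "x \<in> SG"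
  shows "u x = 0"
proof -
  have "chi * inner2 \<mu> (laplacian \<mu> u) (laplacian \<mu> u) \<ge> 0"
    using assms(2) by (intro mult_nonneg_nonneg inner2_nonneg)
  then have "inner2 \<mu> u u = 0"
    using assms(3) inner2_nonneg[of u] unfolding innerS_def by linarith
  then show ?thesis by (rule inner2_0_imp[OF has_laplacianD(2)[OF assms(1)] _ assms(4)])
qed

text \<open>Self-adjointness of Green's operator: Fubini together with the symmetry of the
  kernel.\<close>

lemma inner2_green:
  assumes f: "continuous_on SG f" and g: "continuous_on SG g"
  shows "inner2 \<mu> (\<lambda>x. LINT y:SG|\<mu>. G x y * f y) g = inner2 \<mu> f (\<lambda>x. LINT y:SG|\<mu>. G x y * g y)"
proof -
  have G: "continuous_on (SG \<times> SG) (\<lambda>(x,y). G x y)" "\<And>x y. x \<in> SG \<Longrightarrow> y \<in> SG \<Longrightarrow> G x y = G y x"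
    using green by (auto simp: is_green_def)
  have "inner2 \<mu> (\<lambda>x. LINT y:SG|\<mu>. G x y * f y) g = inner2 \<mu> f (\<lambda>y. LINT x:SG|\<mu>. G x y * g x)"
    unfolding inner2_def by (rule LINT_Fubini[OF G(1) f g])
  also have "\<dots> = inner2 \<mu> f (\<lambda>x. LINT y:SG|\<mu>. G x y * g y)"
    by (rule inner2_cong[OF refl], rule LINT_cong) (simp add: G(2))
  finally show ?thesis .
qed

section \<open>Spans of monomials\<close>

text \<open>The bound is exclusive: \<open>n\<close> counts the monomials, of degrees below
  \<open>n\<close>. Equality is required on \<open>SG\<close> only, as values elsewhere are
  arbitrary.\<close>

definition in_span :: "nat \<Rightarrow> nat \<Rightarrow> (real^2 \<Rightarrow> real) \<Rightarrow> bool" where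
  "in_span l n u \<longleftrightarrow> (\<exists>c. \<forall>x\<in>SG. u x = (\<Sum>i<n. c i * P i l x))"

lemma in_span_cong: "in_span l n u \<Longrightarrow> (\<And>x. x \<in> SG \<Longrightarrow> u x = v x) \<Longrightarrow> in_span l n v"
  by (simp add: in_span_def)

lemma in_span_0: "in_span l n (\<lambda>x. 0)"
  by (auto simp: in_span_def intro: exI[of _ "\<lambda>i. 0"])

lemma in_span_P:
  assumes "i < n"
  shows "in_span l n (P i l)"
proof -
  have "(\<Sum>j<n. of_bool (j = i) * P j l x) = P i l x" for x
  proof -
    have "(\<Sum>j<n. of_bool (j = i) * P j l x) = (\<Sum>j<n. if j = i then P j l x else 0)"
      by (rule sum.cong) auto
    then show ?thesis using assms by simp
  qed
  then show ?thesis unfolding in_span_def by (metis (no_types))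
qed

lemma in_span_add:
  assumes "in_span l n u" "in_span l n v"
  shows "in_span l n (\<lambda>x. u x + v x)"
proof -
  obtain c d where "\<forall>x\<in>SG. u x = (\<Sum>i<n. c i * P i l x)" "\<forall>x\<in>SG. v x = (\<Sum>i<n. d i * P i l x)"
    using assms unfolding in_span_def by blast
  then have "\<forall>x\<in>SG. u x + v x = (\<Sum>i<n. (c i + d i) * P i l x)"
    by (simp add: distrib_right sum.distrib)
  then show ?thesis unfolding in_span_def by (rule exI[of _ "\<lambda>i. c i + d i"])
qed

lemma in_span_scale:
  assumes "in_span l n u"
  shows "in_span l n (\<lambda>x. r * u x)"
proof -
  obtain c where "\<forall>x\<in>SG. u x = (\<Sum>i<n. c i * P i l x)"
    using assms unfolding in_span_def by blast
  then have "\<forall>x\<in>SG. r * u x = (\<Sum>i<n. (r * c i) * P i l x)"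
    by (simp add: sum_distrib_left mult.assoc)
  then show ?thesis unfolding in_span_def by (rule exI[of _ "\<lambda>i. r * c i"])
qed

lemma in_span_sum:
  "(\<And>i. i \<in> I \<Longrightarrow> in_span l n (u i)) \<Longrightarrow> in_span l n (\<lambda>x. \<Sum>i\<in>I. c i * u i x)"
proof (induction I rule: infinite_finite_induct)
  case (insert i I)
  then show ?case
    using in_span_add[OF in_span_scale[of l n "u i" "c i"] insert.IH] by simp
qed (simp_all add: in_span_0)

lemma in_span_mono:
  assumes "in_span l n u" "n \<le> m"
  shows "in_span l m u"
proof -
  obtain c where c: "\<forall>x\<in>SG. u x = (\<Sum>i<n. c i * P i l x)"
    using assms unfolding in_span_def by blast
  have "in_span l m (\<lambda>x. \<Sum>i<n. c i * P i l x)"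
    using assms(2) by (intro in_span_sum in_span_P) auto
  then show ?thesis by (rule in_span_cong) (simp add: c)
qed

lemma in_span_has_laplacian:
  assumes "l \<in> {1,2,3}" "in_span l n u"
  shows "\<exists>f. has_laplacian \<mu> u f"
proof -
  obtain c where c: "\<forall>x\<in>SG. u x = (\<Sum>i<n. c i * P i l x)"
    using assms unfolding in_span_def by blast
  have "has_laplacian \<mu> (P i l) (case i of 0 \<Rightarrow> \<lambda>x. 0 | Suc j \<Rightarrow> P j l)" for i
    using has_laplacian_P_0[OF assms(1)] has_laplacian_P_Suc[OF assms(1)] by (cases i) auto
  then have "has_laplacian \<mu> (\<lambda>x. \<Sum>i<n. c i * P i l x)
      (\<lambda>x. \<Sum>i<n. c i * (case i of 0 \<Rightarrow> \<lambda>x. 0 | Suc j \<Rightarrow> P j l) x)"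
    by (rule has_laplacian_sum)
  from has_laplacian_cong[OF this _ refl, of u] show ?thesis using c by auto
qed

lemma has_laplacian_P:
  assumes "l \<in> {1,2,3}"
  obtains f where "has_laplacian \<mu> (P i l) f"
  using in_span_has_laplacian[OF assms in_span_P[of i "Suc i"]] by auto

text \<open>Applying the Laplacian to a relation kills its \<open>P 0 l\<close> term and lowers the
  other degrees by one, giving a relation one step down.\<close>

lemma not_in_span:
  assumes "l = 2 \<or> l = 3"
  shows "\<not> in_span l n (P n l)"
proof (induction n)
  case 0
  then show ?case using P_0_boundary_neq_0[OF assms] q_SG[of 1] by (auto simp: in_span_def)
next
  case (Suc n)
  have l: "l \<in> {1,2,3}" using assms by auto
  show ?case
  proof
    assume "in_span l (Suc n) (P (Suc n) l)"
    then obtain c where c: "\<forall>x\<in>SG. P (Suc n) l x = (\<Sum>i<Suc n. c i * P i l x)"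
      unfolding in_span_def by blast
    have "has_laplacian \<mu> (\<lambda>x. c 0 * P 0 l x + (\<Sum>i<n. c (Suc i) * P (Suc i) l x))
        (\<lambda>x. c 0 * 0 + (\<Sum>i<n. c (Suc i) * P i l x))"
      by (intro has_laplacian_add has_laplacian_scale has_laplacian_sum has_laplacian_P_0
          has_laplacian_P_Suc l)
    then have "has_laplacian \<mu> (P (Suc n) l) (\<lambda>x. c 0 * 0 + (\<Sum>i<n. c (Suc i) * P i l x))"
      by (rule has_laplacian_cong) (use c in \<open>simp_all add: sum.lessThan_Suc_shift del: sum.lessThan_Suc\<close>)
    from has_laplacian_unique[OF has_laplacian_P_Suc[OF l] this]
    have "in_span l n (P n l)" by (auto simp: in_span_def)
    then show False using Suc.IH by contradiction
  qed
qed

lemma innerS_sum: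
  assumes l: "l \<in> {1,2,3}" and v: "has_laplacian \<mu> v g"
  shows "innerS \<mu> chi (\<lambda>x. \<Sum>i<n. c i * P i l x) v = (\<Sum>i<(n::nat). c i * innerS \<mu> chi (P i l) v)"
proof (induction n)
  case 0
  then show ?case using innerS_scale[OF has_laplacian_0 v, of chi 0] by simp
next
  case (Suc n)
  obtain f where f: "has_laplacian \<mu> (P n l) f" by (rule has_laplacian_P[OF l])
  have "in_span l n (\<lambda>x. \<Sum>i<n. c i * P i l x)" by (auto simp: in_span_def)
  then obtain f' where f': "has_laplacian \<mu> (\<lambda>x. \<Sum>i<n. c i * P i l x) f'"
    using in_span_has_laplacian[OF l] by blast
  show ?case
    using innerS_add[OF f' has_laplacian_scale[OF f] v] innerS_scale[OF f v] Suc by simp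
qed

lemma innerS_in_span_0:
  assumes l: "l \<in> {1,2,3}" and v: "has_laplacian \<mu> v g" and u: "in_span l n u"
    and 0: "\<And>i. i < n \<Longrightarrow> innerS \<mu> chi v (P i l) = 0"
  shows "innerS \<mu> chi v u = 0"
proof -
  obtain c where c: "\<forall>x\<in>SG. u x = (\<Sum>i<n. c i * P i l x)"
    using u unfolding in_span_def by blast
  obtain f where f: "has_laplacian \<mu> u f" using in_span_has_laplacian[OF l u] by blast
  have "innerS \<mu> chi u v = innerS \<mu> chi (\<lambda>x. \<Sum>i<n. c i * P i l x) v"
    using c by (intro innerS_cong[OF f v]) simp
  also have "\<dots> = 0"
    unfolding innerS_sum[OF l v] using 0 by (simp add: innerS_commute[of chi _ v])
  finally show ?thesis by (simp add: innerS_commute[of chi v])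
qed

lemma monic_in_span:
  assumes "\<forall>x\<in>SG. s x = P n l x + (\<Sum>i<n. c i * P i l x)"
  shows "in_span l (Suc n) s"
proof -
  have "in_span l (Suc n) (\<lambda>x. P n l x + (\<Sum>i<n. c i * P i l x))"
    by (intro in_span_add in_span_sum in_span_P) auto
  then show ?thesis by (rule in_span_cong) (simp add: assms)
qed

section \<open>Green's operator on orthogonal polynomials\<close>

text \<open>The Dirichlet solution for \<open>p\<close> is the same combination of the solutions
  \<open>T j\<close> for the \<open>P j l\<close>; \<open>T n\<close> has leading term
  \<open>P (Suc n) l\<close> with coefficient 1, and all remaining terms have degree at most
  \<open>n\<close>.\<close>

lemma green_monic:
  assumes l: "l = 2 \<or> l = 3"
    and p: "\<forall>x\<in>SG. p x = P n l x + (\<Sum>i<n. c i * P i l x)"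
    and f: "\<And>x. x \<in> SG \<Longrightarrow> f x = - (LINT y:SG|\<mu>. G x y * p y)"
  shows "has_laplacian \<mu> f p" "in_span l (Suc n) (\<lambda>x. f x - P (Suc n) l x)"
proof -
  define d where "d j = (SOME d. has_laplacian \<mu> (\<lambda>x. P (Suc j) l x + d * P 0 l x) (P j l) \<and>
    (\<forall>x\<in>V 0. P (Suc j) l x + d * P 0 l x = 0))" for j
  define T where "T j x = P (Suc j) l x + d j * P 0 l x" for j x
  have T: "has_laplacian \<mu> (T j) (P j l) \<and> (\<forall>x\<in>V 0. T j x = 0)" for j
    unfolding T_def[abs_def] d_def by (rule someI_ex[OF green_P[OF l]])
  let ?w = "\<lambda>x. T n x + (\<Sum>i<n. c i * T i x)"
  have "has_laplacian \<mu> ?w (\<lambda>x. P n l x + (\<Sum>i<n. c i * P i l x))"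
    using T by (intro has_laplacian_add has_laplacian_sum) auto
  then have w: "has_laplacian \<mu> ?w p"
    by (rule has_laplacian_cong) (simp_all add: p)
  have fw: "f x = ?w x" if "x \<in> SG" for x
    using green_unique[OF w _ that] f[OF that] T by simp
  show "has_laplacian \<mu> f p"
    by (rule has_laplacian_cong[OF w]) (simp_all add: fw)
  have "in_span l (Suc n) (\<lambda>x. d n * P 0 l x + (\<Sum>i<n. c i * T i x))"
    unfolding T_def by (intro in_span_add in_span_scale in_span_sum in_span_P) auto
  then show "in_span l (Suc n) (\<lambda>x. f x - P (Suc n) l x)"
    by (rule in_span_cong) (simp add: fw T_def)
qed

text \<open>Moving Green's operator from \<open>p\<close> to \<open>P j l\<close> produces degrees
  \<open>Suc j\<close> and 0. The hypothesis \<open>Suc j < n\<close> puts both below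
  \<open>n\<close>, where \<open>p\<close> is orthogonal.\<close>

lemma innerS_green_0:
  assumes l: "l = 2 \<or> l = 3"
    and p: "continuous_on SG p" "\<And>i. i < n \<Longrightarrow> inner2 \<mu> p (P i l) = 0"
    and f: "\<And>x. x \<in> SG \<Longrightarrow> f x = - (LINT y:SG|\<mu>. G x y * p y)" "has_laplacian \<mu> f p"
    and j: "Suc j < n"
  shows "innerS \<mu> chi f (P j l) = 0"
proof -
  have l': "l \<in> {1,2,3}" using l by auto
  have cont: "continuous_on SG (P i l)" for i
    using has_laplacian_P[OF l'] has_laplacianD(2) by metis
  obtain d where d: "has_laplacian \<mu> (\<lambda>x. P (Suc j) l x + d * P 0 l x) (P j l)"
    "\<forall>x\<in>V 0. P (Suc j) l x + d * P 0 l x = 0"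
    using green_P[OF l] by blast
  have T: "P (Suc j) l x + d * P 0 l x = - (LINT y:SG|\<mu>. G x y * P j l y)" if "x \<in> SG" for x
    using d(2) by (intro green_unique[OF d(1) _ that]) simp
  have "inner2 \<mu> f (P j l) = inner2 \<mu> (\<lambda>x. -1 * (LINT y:SG|\<mu>. G x y * p y)) (P j l)"
    by (rule inner2_cong) (simp_all add: f)
  also have "\<dots> = -1 * inner2 \<mu> (\<lambda>x. LINT y:SG|\<mu>. G x y * P j l y) p"
    unfolding inner2_scale inner2_green[OF p(1) cont] by (simp only: inner2_commute)
  also have "\<dots> = inner2 \<mu> (\<lambda>x. -1 * (LINT y:SG|\<mu>. G x y * P j l y)) p"
    by (simp only: inner2_scale)
  also have "\<dots> = inner2 \<mu> (\<lambda>x. P (Suc j) l x + d * P 0 l x) p"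
    by (rule inner2_cong) (simp_all add: T)
  also have "\<dots> = inner2 \<mu> (P (Suc j) l) p + d * inner2 \<mu> (P 0 l) p"
    by (simp add: inner2_add inner2_scale cont p(1) continuous_on_mult)
  also have "\<dots> = 0"
    using p(2)[of "Suc j"] p(2)[of 0] j by (simp add: inner2_commute)
  finally have 1: "inner2 \<mu> f (P j l) = 0" .
  \<comment> \<open>The Laplacian part is the product of \<open>p\<close> with the Laplacian of
    \<open>P j l\<close>: zero for \<open>j = 0\<close>, otherwise a monomial of degree below
    \<open>n\<close>.\<close>
  show ?thesis
  proof (cases j)
    case 0
    show ?thesis using innerS_eq[OF f(2) has_laplacian_P_0[OF l']] 1 0
      by (simp add: inner2_def set_lebesgue_integral_def)
  next
    case (Suc i)
    then have "inner2 \<mu> p (P i l) = 0" using p(2) j by simp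
    then show ?thesis using innerS_eq[OF f(2) has_laplacian_P_Suc[OF l', of i]] 1 Suc by simp
  qed
qed

section \<open>The recursion\<close>

text \<open>Stated for one \<open>n\<close> with natural indices; \<open>t\<close> stands for the
  predecessor of \<open>s n\<close> and is the zero function for \<open>n = 0\<close>.\<close>

lemma sobolev_recursion:
  assumes l: "l = 2 \<or> l = 3" and chi: "chi > 0"
    and p: "monic_orthogonal (inner2 \<mu>) (\<lambda>j. P j l) p"
    and s: "monic_orthogonal (innerS \<mu> chi) (\<lambda>j. P j l) s"
    and f: "\<And>x. x \<in> SG \<Longrightarrow> f x = - (LINT y:SG|\<mu>. G x y * p n y)"
    and t: "t = (case n of 0 \<Rightarrow> \<lambda>x. 0 | Suc m \<Rightarrow> s m)"
    and a: "a = innerS \<mu> chi f (s n) / innerS \<mu> chi (s n) (s n)"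
    and b: "b = innerS \<mu> chi f t / innerS \<mu> chi t t"
    and x: "x \<in> SG"
  shows "s (Suc n) x + a * s n x + b * t x = f x"
proof -
  have l': "l \<in> {1,2,3}" using l by auto
  have smon: "\<exists>c. \<forall>x\<in>SG. s m x = P m l x + (\<Sum>i<m. c i * P i l x)" for m
    using s unfolding monic_orthogonal_def by blast
  have sspan: "in_span l (Suc m) (s m)" for m
    using smon[of m] monic_in_span by blast
  have "\<exists>g. has_laplacian \<mu> (s m) g" for m
    by (rule in_span_has_laplacian[OF l' sspan])
  then obtain \<sigma> where \<sigma>: "\<And>m. has_laplacian \<mu> (s m) (\<sigma> m)" by metis
  have sorth: "innerS \<mu> chi (s m) u = 0" if "in_span l m u" for m u
    using s by (intro innerS_in_span_0[OF l' \<sigma> that]) (simp add: monic_orthogonal_def)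
  obtain c where c: "\<forall>x\<in>SG. p n x = P n l x + (\<Sum>i<n. c i * P i l x)"
    using p unfolding monic_orthogonal_def by blast
  have fp: "has_laplacian \<mu> f (p n)" "in_span l (Suc n) (\<lambda>x. f x - P (Suc n) l x)"
    using green_monic[OF l c] f by blast+
  have porth: "inner2 \<mu> (p n) (P i l) = 0" if "i < n" for i
    using p that unfolding monic_orthogonal_def by blast
  \<comment> \<open>Truncated subtraction: for \<open>n = 0\<close> and \<open>n = 1\<close> the
    span contains only functions vanishing on \<open>SG\<close>.\<close>
  have forth: "innerS \<mu> chi f u = 0" if "in_span l (n - 1) u" for u
  proof (rule innerS_in_span_0[OF l' fp(1) that])
    fix i assume "i < n - 1"
    then show "innerS \<mu> chi f (P i l) = 0"
      using innerS_green_0[OF l has_laplacianD(3)[OF fp(1)] porth f fp(1)] by simp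
  qed
  have tspan: "in_span l n t"
    using t sspan in_span_0 by (cases n) auto
  obtain \<tau> where \<tau>: "has_laplacian \<mu> t \<tau>"
    using in_span_has_laplacian[OF l' tspan] by blast
  \<comment> \<open>A zero norm would make \<open>s m\<close> vanish on \<open>SG\<close> and so put
    its leading monomial into the span of the lower ones.\<close>
  have spos: "innerS \<mu> chi (s m) (s m) \<noteq> 0" for m
  proof
    assume *: "innerS \<mu> chi (s m) (s m) = 0"
    have 0: "s m x = 0" if "x \<in> SG" for x
      by (rule innerS_0_imp[OF \<sigma> less_imp_le[OF chi] * that])
    obtain c where c: "\<forall>x\<in>SG. s m x = P m l x + (\<Sum>i<m. c i * P i l x)" using smon by blast
    have "in_span l m (\<lambda>x. -1 * (\<Sum>i<m. c i * P i l x))"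
      by (intro in_span_scale in_span_sum in_span_P) auto
    then have "in_span l m (P m l)"
      by (rule in_span_cong) (use c 0 in force)
    then show False using not_in_span[OF l] by blast
  qed
  define r where "r x = f x + (-1 * s (Suc n) x + (- a * s n x + - b * t x))" for x
  let ?\<rho> = "\<lambda>x. p n x + (-1 * \<sigma> (Suc n) x + (- a * \<sigma> n x + - b * \<tau> x))"
  have \<rho>: "has_laplacian \<mu> r ?\<rho>"
    unfolding r_def[abs_def] by (intro has_laplacian_add has_laplacian_scale \<sigma> \<tau> fp(1))
  have ip: "innerS \<mu> chi r v = innerS \<mu> chi f v - innerS \<mu> chi (s (Suc n)) v
      - a * innerS \<mu> chi (s n) v - b * innerS \<mu> chi t v" if v: "has_laplacian \<mu> v g" for v g
    unfolding r_def[abs_def]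
    by (simp only: innerS_add[OF _ _ v] innerS_scale[OF _ v] fp(1) \<sigma> \<tau>
        innerS_add[OF fp(1) has_laplacian_add[OF has_laplacian_scale[OF \<sigma>]
          has_laplacian_add[OF has_laplacian_scale[OF \<sigma>] has_laplacian_scale[OF \<tau>]]] v]
        innerS_add[OF has_laplacian_scale[OF \<sigma>]
          has_laplacian_add[OF has_laplacian_scale[OF \<sigma>] has_laplacian_scale[OF \<tau>]] v]
        innerS_add[OF has_laplacian_scale[OF \<sigma>] has_laplacian_scale[OF \<tau>] v]
        innerS_scale[OF \<sigma> v] innerS_scale[OF \<tau> v])
  \<comment> \<open>Both \<open>f\<close> and \<open>s (Suc n)\<close> have leading term
    \<open>P (Suc n) l\<close> with coefficient 1, which cancels in \<open>r\<close>.\<close>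
  have rspan: "in_span l (Suc n) r"
  proof -
    obtain e where e: "\<forall>x\<in>SG. s (Suc n) x = P (Suc n) l x + (\<Sum>i<Suc n. e i * P i l x)"
      using smon by blast
    have "in_span l (Suc n) (\<lambda>x. (f x - P (Suc n) l x) +
        (-1 * (\<Sum>i<Suc n. e i * P i l x) + (- a * s n x + - b * t x)))"
      by (intro in_span_add in_span_scale in_span_sum in_span_P sspan fp(2) in_span_mono[OF tspan]) auto
    then show ?thesis
      by (rule in_span_cong) (simp add: r_def e)
  qed
  have rs: "innerS \<mu> chi r (s j) = 0" if "j \<le> n" for j
  proof -
    have 1: "innerS \<mu> chi (s (Suc n)) (s j) = 0"
      using that by (intro sorth in_span_mono[OF sspan]) simp
    \<comment> \<open>For \<open>j = n\<close> and \<open>j = n - 1\<close> the choices of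
      \<open>a\<close> and \<open>b\<close> cancel the product of \<open>f\<close> with
      \<open>s j\<close>; for smaller \<open>j\<close> every product vanishes separately.\<close>
    have "j = n \<or> n = Suc j \<or> Suc j < n" using that by auto
    then consider "j = n" | "n = Suc j" | "Suc j < n" by blast
    then show ?thesis
    proof cases
      case 1
      have "innerS \<mu> chi t (s n) = 0"
        using sorth[OF tspan] by (simp add: innerS_commute[of chi t])
      then show ?thesis
        using ip[OF \<sigma>[of n]] \<open>innerS \<mu> chi (s (Suc n)) (s j) = 0\<close> spos[of n] a 1 by simp
    next
      case 2
      then have "innerS \<mu> chi (s n) (s j) = 0" "t = s j"
        using sorth[of n "s j"] sspan[of j] t by simp_all
      then show ?thesis
        using ip[OF \<sigma>[of j]] 1 spos[of j] b by simp
    next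
      case 3
      then obtain m where m: "n = Suc m" "t = s m" "j < m" using t by (cases n) auto
      have "innerS \<mu> chi f (s j) = 0" "innerS \<mu> chi (s n) (s j) = 0" "innerS \<mu> chi t (s j) = 0"
        unfolding m(2) using m(1,3)
        by (intro forth sorth in_span_mono[OF sspan]; simp)+
      then show ?thesis using ip[OF \<sigma>[of j]] 1 by simp
    qed
  qed
  \<comment> \<open>Orthogonality passes from \<open>s j\<close> to \<open>P j l\<close>, as the two
    differ by lower monomials, which are covered by the induction.\<close>
  have rP: "innerS \<mu> chi r (P j l) = 0" if "j < Suc n" for j
    using that
  proof (induction j rule: less_induct)
    case (less j)
    obtain c where c: "\<forall>x\<in>SG. s j x = P j l x + (\<Sum>i<j. c i * P i l x)" using smon by blast
    have "in_span l j (\<lambda>x. \<Sum>i<j. c i * P i l x)" by (auto simp: in_span_def)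
    then obtain g where g: "has_laplacian \<mu> (\<lambda>x. \<Sum>i<j. c i * P i l x) g"
      using in_span_has_laplacian[OF l'] by blast
    obtain h where h: "has_laplacian \<mu> (P j l) h" by (rule has_laplacian_P[OF l'])
    have "innerS \<mu> chi (s j) r = innerS \<mu> chi (\<lambda>x. P j l x + (\<Sum>i<j. c i * P i l x)) r"
      using c by (intro innerS_cong[OF \<sigma> \<rho>]) simp
    also have "\<dots> = innerS \<mu> chi (P j l) r + (\<Sum>i<j. c i * innerS \<mu> chi (P i l) r)"
      unfolding innerS_add[OF h g \<rho>] innerS_sum[OF l' \<rho>] ..
    also have "(\<Sum>i<j. c i * innerS \<mu> chi (P i l) r) = 0"
      using less by (intro sum.neutral) (simp add: innerS_commute[of chi _ r])
    finally show ?case using rs[of j] less.prems by (simp add: innerS_commute[of chi _ r])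
  qed
  have "innerS \<mu> chi r r = 0"
    by (rule innerS_in_span_0[OF l' \<rho> rspan rP])
  then have "r x = 0" by (rule innerS_0_imp[OF \<rho> less_imp_le[OF chi] _ x])
  then show ?thesis by (simp add: r_def)
qed

end

theorem theorem3p2:
  fixes \<mu> :: "(real^2) measure"
    and G :: "real^2 \<Rightarrow> real^2 \<Rightarrow> real"
    and P :: "nat \<Rightarrow> nat \<Rightarrow> real^2 \<Rightarrow> real"
    and p f :: "nat \<Rightarrow> real^2 \<Rightarrow> real"
    and s :: "int \<Rightarrow> real^2 \<Rightarrow> real"
    and a b :: "nat \<Rightarrow> real"
    and chi :: real and k :: nat
  assumes "is_SG_measure \<mu>"
    and "is_green \<mu> G"
    and "\<And>j l. l \<in> {1,2,3} \<Longrightarrow> is_monomial \<mu> j l (P j l)"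
    and "k = 2 \<or> k = 3"
    and "chi > 0"
    and "monic_orthogonal (inner2 \<mu>) (\<lambda>j. P j k) p"
    and "monic_orthogonal (innerS \<mu> chi) (\<lambda>j. P j k) (\<lambda>n. s (int n))"
    and "s (-1) = (\<lambda>x. 0)"
    and "\<And>n x. x \<in> SG \<Longrightarrow> f (n + 1) x = - (LINT y:SG|\<mu>. G x y * p n y)"
    and "\<And>n. a n = innerS \<mu> chi (f (n + 1)) (s (int n)) / (normS \<mu> chi (s (int n)))\<^sup>2"
    and "\<And>n. b n = innerS \<mu> chi (f (n + 1)) (s (int n - 1)) / (normS \<mu> chi (s (int n - 1)))\<^sup>2"
  shows "\<forall>n. \<forall>x\<in>SG. s (int n + 1) x + a n * s (int n) x + b n * s (int n - 1) x = f (n + 1) x"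
proof (intro allI ballI)
  fix n x assume x: "x \<in> SG"
  interpret green_monomials \<mu> G P
    using assms(1-3) by unfold_locales
  have norm: "(normS \<mu> chi u)\<^sup>2 = innerS \<mu> chi u u" for u
    unfolding normS_def using assms(5) by (intro real_sqrt_pow2 innerS_nonneg) simp
  \<comment> \<open>Translates the integer index: for \<open>n = 0\<close> it is -1, where the
    sequence is prescribed to be zero.\<close>
  have t: "s (int n - 1) = (case n of 0 \<Rightarrow> \<lambda>x. 0 | Suc m \<Rightarrow> s (int m))"
    using assms(8) by (cases n) auto
  have "s (int (Suc n)) x + a n * s (int n) x + b n * s (int n - 1) x = f (n + 1) x"
    by (rule sobolev_recursion[OF assms(4-7) assms(9) t assms(10)[unfolded norm]
          assms(11)[unfolded norm] x])
  then show "s (int n + 1) x + a n * s (int n) x + b n * s (int n - 1) x = f (n + 1) x"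
    by (simp add: add.commute)
qed

end
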